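(* Let $g\ge1$ and $n>1$. Let $V_{n-1,g}$ be the free group with basis $\tau_2,\dots,\tau_{n-1},w_1,\dots,w_{2g}$, and put $$\tau_1=[w_1^{-1},w_2][w_3^{-1},w_4]\cdots[w_{2g-1}^{-1},w_{2g}]\,\tau_{n-1}^{-1}\cdots\tau_2^{-1}\in V_{n-1,g}.$$ There exists a representation $\rho_{\widetilde V}:B_{n-1}(\Sigma_g)\to\mathrm{Out}(V_{n-1,g})$ sending each generator $\sigma_k$ ($1\le k\le n-2$) and $x_r$ ($1\le r\le 2g$) of $B_{n-1}(\Sigma_g)$ to the class of the automorphism, written $u\mapsto u^{\sigma_k}$, respectively $u\mapsto u^{x_r}$, given by: Action (up to conjugacy) on $\tau_2,\dots,\tau_{n-1}$: (S1) $\tau_l^{\sigma_k}=\tau_l$ for $k\ne l-1,l$; (S2) $\tau_l^{\sigma_{l-1}}=\tau_{l-1}$; (S3) $\tau_l^{\sigma_l}=\tau_{l+1}^{\tau_l^{-1}}$ for $l\ne n-1$; (S4) $\tau_i^{x_r}=\tau_i$ for $2\le i\le n-1$, $1\le r\le2g$. Action (up to conjugacy) on $w_1,\dots,w_{2g}$: (S5) $w_r^{\sigma_i}=w_r$ for $1\le r\le2g$, $1\le i\le n-2$; (S6) $w_r^{x_r}=w_r^{\tau_1}$ for $1\le r\le 2g$; (S7) $\tau_1^{x_r}=\tau_1^{w_r^{-1}\tau_1}$ for $1\le r\le2g$; (S8) $w_s^{x_r}=w_s^{[w_r^{-1},\tau_1]}$ for $1\le s<r\le2g$, $(s,r)\ne(2m-1,2m)$;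 (S9) $w_r^{x_s}=w_r$ for $1\le s<r\le2g$, $(s,r)\ne(2m-1,2m)$; (S10) $w_{2m-1}^{x_{2m}}=[\tau_1,w_{2m}^{-1}]\,w_{2m-1}\tau_1$ for $1\le m\le g$; (S11) $w_{2m}^{x_{2m-1}}=\tau_1^{-1}w_{2m}$ for $1\le m\le g$.
   Context: Conventions: for elements $a,b$ of a group, $a^b=b^{-1}ab$ and $[a,b]=a^{-1}b^{-1}ab$. Automorphisms act on the right: a product $\alpha\beta$ of automorphisms means first $\alpha$, then $\beta$. "$(s,r)\ne(2m-1,2m)$" means that $(s,r)$ is not of this form for any integer $m$. $\Sigma_g$ is the closed connected orientable surface of genus $g$. $B_m(\Sigma_g)$ is the $m$-strand braid group of $\Sigma_g$: isotopy classes (rel endpoints) of $m$-tuples of disjoint paths in $\Sigma_g\times[0,1]$, monotone in the $[0,1]$ coordinate, from $\mathcal P\times\{0\}$ to $\mathcal P\times\{1\}$, with $\mathcal P$ a fixed set of $m$ points. For $g\ge1$ and $m\ge2$ it has the presentation (known) with generators $\sigma_1,\dots,\sigma_{m-1},x_1,\dots,x_{2g}$ and relations: $\sigma_i\sigma_{i+1}\sigma_i=\sigma_{i+1}\sigma_i\sigma_{i+1}$; $\sigma_i\sigma_j=\sigma_j\sigma_i$ for $|i-j|>1$; $x_r\sigma_i=\sigma_ix_r$ for $i\ne1$; $(\sigma_1^{-1}x_r\sigma_1^{-1})x_r=x_r(\sigma_1^{-1}x_r\sigma_1^{-1})$; $(\sigma_1^{-1}x_s\sigma_1)x_r=x_r(\sigma_1^{-1}x_s\sigma_1)$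 for $s<r$, $(s,r)\ne(2m'-1,2m')$; $(\sigma_1^{-1}x_{2m'-1}\sigma_1^{-1})x_{2m'}=x_{2m'}(\sigma_1^{-1}x_{2m'-1}\sigma_1)$ for $1\le m'\le g$; $[x_1^{-1},x_2]\cdots[x_{2g-1}^{-1},x_{2g}]=\sigma_1\sigma_2\cdots\sigma_{m-2}\sigma_{m-1}^2\sigma_{m-2}\cdots\sigma_2\sigma_1$. For $m=1$, $B_1(\Sigma_g)=\pi_1(\Sigma_g)$ with generators $x_1,\dots,x_{2g}$ and the single relation $[x_1^{-1},x_2]\cdots[x_{2g-1}^{-1},x_{2g}]=1$. *)

theory Defs
  imports "HOL-Algebra.Coset" "HOL-Algebra.Bij"
begin

section \<open>Group notation\<close>

definition gconj :: "('a, 'b) monoid_scheme \<Rightarrow> 'a \<Rightarrow> 'a \<Rightarrow> 'a"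
  where "gconj G a b = inv\<^bsub>G\<^esub> b \<otimes>\<^bsub>G\<^esub> a \<otimes>\<^bsub>G\<^esub> b"

definition gcomm :: "('a, 'b) monoid_scheme \<Rightarrow> 'a \<Rightarrow> 'a \<Rightarrow> 'a"
  where "gcomm G a b = inv\<^bsub>G\<^esub> a \<otimes>\<^bsub>G\<^esub> inv\<^bsub>G\<^esub> b \<otimes>\<^bsub>G\<^esub> a \<otimes>\<^bsub>G\<^esub> b"

text \<open>The ordered product of a list, from left to right.\<close>

definition gprod :: "('a, 'b) monoid_scheme \<Rightarrow> 'a list \<Rightarrow> 'a"
  where "gprod G xs = foldr (\<lambda>a b. a \<otimes>\<^bsub>G\<^esub> b) xs \<one>\<^bsub>G\<^esub>"

lemma (in group) gconj_closed [simp]: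
  "a \<in> carrier G \<Longrightarrow> b \<in> carrier G \<Longrightarrow> gconj G a b \<in> carrier G"
  by (simp add: gconj_def)

lemma (in group) gcomm_closed [simp]:
  "a \<in> carrier G \<Longrightarrow> b \<in> carrier G \<Longrightarrow> gcomm G a b \<in> carrier G"
  by (simp add: gcomm_def)

lemma (in group) gprod_closed [simp]:
  "set xs \<subseteq> carrier G \<Longrightarrow> gprod G xs \<in> carrier G"
  by (induction xs) (auto simp: gprod_def)


section \<open>Free groups\<close>

text \<open>The letters \<open>(a, True)\<close> and \<open>(a, False)\<close> stand for the generator \<open>a\<close> and for its inverse.
  The elements of the free group are the freely reduced words.\<close>

type_synonym 'a word = "('a \<times> bool) list"

definition inv_letter :: "'a \<times> bool \<Rightarrow> 'a \<times> bool"
  where "inv_letter x = (fst x, \<not> snd x)"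

fun reduced :: "'a word \<Rightarrow> bool" where
  "reduced (x # y # w) \<longleftrightarrow> y \<noteq> inv_letter x \<and> reduced (y # w)"
| "reduced _ \<longleftrightarrow> True"

fun cons_reduce :: "'a \<times> bool \<Rightarrow> 'a word \<Rightarrow> 'a word" where
  "cons_reduce x [] = [x]"
| "cons_reduce x (y # w) = (if y = inv_letter x then w else x # y # w)"

definition reduce :: "'a word \<Rightarrow> 'a word"
  where "reduce w = foldr cons_reduce w []"

definition free_group :: "'a set \<Rightarrow> 'a word monoid"
  where "free_group S =
    \<lparr>carrier = {w. reduced w \<and> fst ` set w \<subseteq> S}, mult = \<lambda>u v. reduce (u @ v), one = []\<rparr>"

definition free_gen :: "'a \<Rightarrow> 'a word"
  where "free_gen a = [(a, True)]"

lemma inv_letter_inv_letter [simp]: "inv_letter (inv_letter x) = x"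
  by (simp add: inv_letter_def)

lemma fst_inv_letter [simp]: "fst (inv_letter x) = fst x"
  by (simp add: inv_letter_def)

lemma reduced_tl: "reduced (x # w) \<Longrightarrow> reduced w"
  by (cases w) auto

lemma reduced_cons_reduce: "reduced w \<Longrightarrow> reduced (cons_reduce x w)"
  by (cases w) (auto dest: reduced_tl)

lemma cons_reduce_cancel: "reduced w \<Longrightarrow> cons_reduce x (cons_reduce (inv_letter x) w) = w"
  by (cases w rule: reduced.cases) auto

lemma cons_reduce_cancel': "reduced w \<Longrightarrow> cons_reduce (inv_letter x) (cons_reduce x w) = w"
  using cons_reduce_cancel [of w "inv_letter x"] by simp

lemma reduced_foldr: "reduced w \<Longrightarrow> reduced (foldr cons_reduce u w)"
  by (induction u) (auto intro: reduced_cons_reduce)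

lemma reduced_reduce: "reduced (reduce w)"
  unfolding reduce_def by (rule reduced_foldr) simp

lemma foldr_cons_reduce:
  "reduced w \<Longrightarrow> foldr cons_reduce (cons_reduce x u) w = cons_reduce x (foldr cons_reduce u w)"
  by (cases u) (auto simp: cons_reduce_cancel reduced_foldr)

lemma foldr_reduce: "reduced w \<Longrightarrow> foldr cons_reduce (reduce u) w = foldr cons_reduce u w"
  by (induction u) (auto simp: reduce_def foldr_cons_reduce)

lemma reduce_idem: "reduced w \<Longrightarrow> reduce w = w"
  unfolding reduce_def
proof (induction w)
  case (Cons x w)
  then show ?case by (cases w) auto
qed simp

lemma reduce_append: "reduce (u @ v) = foldr cons_reduce u (reduce v)"
  by (simp add: reduce_def)

lemma reduce_reduce_append: "reduce (reduce u @ v) = reduce (u @ v)"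
  by (simp add: reduce_append foldr_reduce reduced_reduce)

lemma reduce_append_reduce: "reduce (u @ reduce v) = reduce (u @ v)"
  by (simp add: reduce_append reduce_idem reduced_reduce)

lemma set_cons_reduce: "set (cons_reduce x w) \<subseteq> insert x (set w)"
  by (cases w) auto

lemma set_reduce: "set (reduce w) \<subseteq> set w"
  unfolding reduce_def
proof (induction w)
  case (Cons x w)
  then show ?case using set_cons_reduce [of x "foldr cons_reduce w []"] by auto
qed simp

lemma reduce_inverse: "reduce (rev (map inv_letter w) @ w) = []"
proof (induction w)
  case (Cons x w)
  have "reduce (rev (map inv_letter (x # w)) @ x # w)
      = foldr cons_reduce (rev (map inv_letter w))
          (cons_reduce (inv_letter x) (cons_reduce x (reduce w)))"
    by (simp add: reduce_def)
  also have "\<dots> = reduce (rev (map inv_letter w) @ w)"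
    by (simp add: cons_reduce_cancel' reduced_reduce reduce_append)
  finally show ?case using Cons by simp
qed (simp add: reduce_def)

lemma group_free_group: "group (free_group S)"
proof (rule groupI)
  fix u assume u: "u \<in> carrier (free_group S)"
  let ?v = "rev (map inv_letter u)"
  show "\<exists>y\<in>carrier (free_group S). y \<otimes>\<^bsub>free_group S\<^esub> u = \<one>\<^bsub>free_group S\<^esub>"
  proof
    show "reduce ?v \<in> carrier (free_group S)"
      using u set_reduce [of ?v] by (fastforce simp: free_group_def reduced_reduce)
    show "reduce ?v \<otimes>\<^bsub>free_group S\<^esub> u = \<one>\<^bsub>free_group S\<^esub>"
      by (simp add: free_group_def reduce_reduce_append reduce_inverse)
  qed
next
  fix u v assume "u \<in> carrier (free_group S)" "v \<in> carrier (free_group S)"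
  then show "u \<otimes>\<^bsub>free_group S\<^esub> v \<in> carrier (free_group S)"
    using set_reduce [of "u @ v"] by (fastforce simp: free_group_def reduced_reduce)
qed (auto simp: free_group_def reduce_reduce_append reduce_append_reduce reduce_idem)

lemma one_free_group_closed [simp]: "\<one>\<^bsub>free_group S\<^esub> \<in> carrier (free_group S)"
  by (simp add: free_group_def)

lemma free_gen_closed [simp]: "a \<in> S \<Longrightarrow> free_gen a \<in> carrier (free_group S)"
  by (simp add: free_group_def free_gen_def)

theorem free_group_universal:
  assumes "group H" and f: "f \<in> S \<rightarrow> carrier H"
  shows "\<exists>!h. h \<in> hom (free_group S) H \<inter> extensional (carrier (free_group S)) \<and>
    (\<forall>a\<in>S. h (free_gen a) = f a)"
proof -
  interpret H: group H by fact
  interpret F: group "free_group S" by (rule group_free_group)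
  define l where "l x = (if snd x then f (fst x) else inv\<^bsub>H\<^esub> f (fst x))" for x
  define e where "e w = foldr (\<lambda>x b. l x \<otimes>\<^bsub>H\<^esub> b) w \<one>\<^bsub>H\<^esub>" for w
  have e_simps [simp]: "e [] = \<one>\<^bsub>H\<^esub>" "\<And>x w. e (x # w) = l x \<otimes>\<^bsub>H\<^esub> e w"
    by (simp_all add: e_def)
  have l_cl: "l x \<in> carrier H" if "fst x \<in> S" for x
    using that f by (auto simp: l_def)
  have l_inv: "l x \<otimes>\<^bsub>H\<^esub> l (inv_letter x) = \<one>\<^bsub>H\<^esub>" if "fst x \<in> S" for x
  proof -
    have "f (fst x) \<in> carrier H" using that f by blast
    then show ?thesis by (simp add: l_def inv_letter_def)
  qed
  have e_cl: "e w \<in> carrier H" if "fst ` set w \<subseteq> S" for w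
    using that by (induction w) (auto intro: l_cl)
  have e_cons: "e (cons_reduce x w) = l x \<otimes>\<^bsub>H\<^esub> e w"
    if "fst x \<in> S" "fst ` set w \<subseteq> S" for x w
  proof (cases w)
    case (Cons y v)
    show ?thesis
    proof (cases "y = inv_letter x")
      case True
      have "l x \<otimes>\<^bsub>H\<^esub> (l (inv_letter x) \<otimes>\<^bsub>H\<^esub> e v)
          = (l x \<otimes>\<^bsub>H\<^esub> l (inv_letter x)) \<otimes>\<^bsub>H\<^esub> e v"
        using that Cons True by (intro H.m_assoc [symmetric] l_cl e_cl) auto
      then show ?thesis using Cons True that by (simp add: l_inv e_cl)
    qed (simp add: Cons)
  qed simp
  have e_red: "e (reduce w) = e w" if "fst ` set w \<subseteq> S" for w
    using that
  proof (induction w)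
    case (Cons x w)
    have "fst ` set (reduce w) \<subseteq> S" using Cons.prems set_reduce [of w] by fastforce
    then have "e (cons_reduce x (reduce w)) = l x \<otimes>\<^bsub>H\<^esub> e (reduce w)"
      using Cons.prems by (intro e_cons) auto
    then show ?case using Cons by (simp add: reduce_def)
  qed (simp add: reduce_def)
  have e_app: "e (u @ v) = e u \<otimes>\<^bsub>H\<^esub> e v" if "fst ` set u \<subseteq> S" "fst ` set v \<subseteq> S" for u v
    using that by (induction u) (auto simp: l_cl e_cl H.m_assoc)
  define h where "h = restrict e (carrier (free_group S))"
  have h_hom: "h \<in> hom (free_group S) H"
  proof (rule homI)
    fix u v assume uv: "u \<in> carrier (free_group S)" "v \<in> carrier (free_group S)"
    then have "e (u \<otimes>\<^bsub>free_group S\<^esub> v) = e u \<otimes>\<^bsub>H\<^esub> e v"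
      using e_red [of "u @ v"] by (auto simp: free_group_def e_app)
    then show "h (u \<otimes>\<^bsub>free_group S\<^esub> v) = h u \<otimes>\<^bsub>H\<^esub> h v"
      using uv F.m_closed [OF uv] by (simp add: h_def)
  next
    fix u assume "u \<in> carrier (free_group S)"
    then show "h u \<in> carrier H" unfolding h_def by (auto simp: free_group_def intro: e_cl)
  qed
  show ?thesis
  proof (rule ex1I [of _ h])
    have "h (free_gen a) = f a" if "a \<in> S" for a
    proof -
      have "f a \<in> carrier H" using that f by blast
      then show ?thesis using that by (simp add: h_def) (simp add: free_gen_def l_def)
    qed
    then show "h \<in> hom (free_group S) H \<inter> extensional (carrier (free_group S)) \<and>
        (\<forall>a\<in>S. h (free_gen a) = f a)"
      using h_hom by (simp add: h_def)
  next
    fix k assume k: "k \<in> hom (free_group S) H \<inter> extensional (carrier (free_group S)) \<and>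
        (\<forall>a\<in>S. k (free_gen a) = f a)"
    interpret k: group_hom "free_group S" H k
      using k by unfold_locales auto
    have k_letter: "k [x] = l x" if "fst x \<in> S" for x
    proof (cases "snd x")
      case True
      then have "[x] = free_gen (fst x)" by (simp add: free_gen_def prod_eq_iff)
      then show ?thesis using k that True by (simp add: l_def)
    next
      case False
      have cl: "[x] \<in> carrier (free_group S)" using that by (simp add: free_group_def)
      have "[x] \<otimes>\<^bsub>free_group S\<^esub> free_gen (fst x) = \<one>\<^bsub>free_group S\<^esub>"
        using False by (simp add: free_group_def free_gen_def reduce_def inv_letter_def)
      then have "[x] = inv\<^bsub>free_group S\<^esub> free_gen (fst x)"
        using cl that by (simp add: F.inv_equality)
      then show ?thesis using k that False by (simp add: l_def)
    qed
    have "k w = e w" if "w \<in> carrier (free_group S)" for w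
      using that
    proof (induction w)
      case Nil
      show ?case using k.hom_one by (simp add: free_group_def)
    next
      case (Cons x w)
      have x: "fst x \<in> S" and r: "reduced (x # w)"
        using Cons.prems by (auto simp: free_group_def)
      have w: "w \<in> carrier (free_group S)"
        using Cons.prems reduced_tl [OF r] by (auto simp: free_group_def)
      have x': "[x] \<in> carrier (free_group S)" using x by (simp add: free_group_def)
      have "[x] \<otimes>\<^bsub>free_group S\<^esub> w = x # w"
        using r by (simp add: free_group_def reduce_idem)
      then show ?case
        using k.hom_mult [OF x' w] Cons.IH [OF w] k_letter [OF x] by simp
    qed
    then show "k = h"
      using k by (intro extensionalityI [of _ "carrier (free_group S)"]) (auto simp: h_def)
  qed
qed


section \<open>Groups given by generators and relations\<close>

definition normal_closure :: "('a, 'b) monoid_scheme \<Rightarrow> 'a set \<Rightarrow> 'a set"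
  where "normal_closure G R = \<Inter> {N. N \<lhd> G \<and> R \<subseteq> N}"

text \<open>A pair \<open>(u, v)\<close> of words encodes the relation \<open>u = v\<close>.\<close>

definition relation_subgroup :: "'a set \<Rightarrow> ('a word \<times> 'a word) set \<Rightarrow> 'a word set"
  where "relation_subgroup S R = normal_closure (free_group S)
    {u \<otimes>\<^bsub>free_group S\<^esub> inv\<^bsub>free_group S\<^esub> v | u v. (u, v) \<in> R}"

definition presented_group :: "'a set \<Rightarrow> ('a word \<times> 'a word) set \<Rightarrow> 'a word set monoid"
  where "presented_group S R = free_group S Mod relation_subgroup S R"

definition presented_gen :: "'a set \<Rightarrow> ('a word \<times> 'a word) set \<Rightarrow> 'a \<Rightarrow> 'a word set"
  where "presented_gen S R a = relation_subgroup S R #>\<^bsub>free_group S\<^esub> free_gen a"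

lemma (in group) normal_carrier: "carrier G \<lhd> G"
  using subgroup_self by (simp add: normal_inv_iff)

lemma (in group) normal_closure_normal:
  assumes "R \<subseteq> carrier G"
  shows "normal_closure G R \<lhd> G"
proof -
  have ne: "{N. N \<lhd> G \<and> R \<subseteq> N} \<noteq> {}"
    using normal_carrier assms by blast
  have "subgroup (normal_closure G R) G"
    unfolding normal_closure_def
    by (rule subgroups_Inter [OF _ ne]) (auto simp: normal_imp_subgroup)
  then show ?thesis
    by (auto simp: normal_inv_iff normal_closure_def)
qed

lemma group_presented_group:
  assumes "R \<subseteq> carrier (free_group S) \<times> carrier (free_group S)"
  shows "group (presented_group S R)"
proof -
  interpret F: group "free_group S" by (rule group_free_group)
  have "relation_subgroup S R \<lhd> free_group S"
    unfolding relation_subgroup_def using assms by (intro F.normal_closure_normal) auto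
  then show ?thesis
    unfolding presented_group_def by (rule normal.factorgroup_is_group)
qed


section \<open>Outer automorphisms\<close>

text \<open>Automorphisms act on the right, so the product of \<open>\<alpha>\<close> and \<open>\<beta>\<close> is first \<open>\<alpha>\<close>, then \<open>\<beta>\<close>;
  in \<^const>\<open>AutoGroup\<close> it is first \<open>\<beta>\<close>, then \<open>\<alpha>\<close>.\<close>

definition Aut :: "('a, 'b) monoid_scheme \<Rightarrow> ('a \<Rightarrow> 'a) monoid"
  where "Aut G = AutoGroup G \<lparr>mult := \<lambda>\<alpha> \<beta>. \<beta> \<otimes>\<^bsub>AutoGroup G\<^esub> \<alpha>\<rparr>"

definition Inn :: "('a, 'b) monoid_scheme \<Rightarrow> ('a \<Rightarrow> 'a) set"
  where "Inn G = {\<lambda>u\<in>carrier G. gconj G u c | c. c \<in> carrier G}"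

definition Out :: "('a, 'b) monoid_scheme \<Rightarrow> ('a \<Rightarrow> 'a) set monoid"
  where "Out G = Aut G Mod Inn G"

definition out_class :: "('a, 'b) monoid_scheme \<Rightarrow> ('a \<Rightarrow> 'a) \<Rightarrow> ('a \<Rightarrow> 'a) set"
  where "out_class G \<alpha> = Inn G #>\<^bsub>Aut G\<^esub> \<alpha>"

lemma carrier_Aut: "carrier (Aut G) = auto G"
  by (simp add: Aut_def AutoGroup_def)

lemma one_Aut: "\<one>\<^bsub>Aut G\<^esub> = (\<lambda>u\<in>carrier G. u)"
  by (simp add: Aut_def AutoGroup_def BijGroup_def)

lemma mult_Aut:
  assumes "\<alpha> \<in> auto G" "\<beta> \<in> auto G"
  shows "\<alpha> \<otimes>\<^bsub>Aut G\<^esub> \<beta> = (\<lambda>u\<in>carrier G. \<beta> (\<alpha> u))"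
  using assms by (simp add: Aut_def AutoGroup_def BijGroup_def auto_def compose_def)

lemma (in group) group_Aut: "group (Aut G)"
proof -
  interpret A: group "AutoGroup G" by (rule AutoGroup)
  show ?thesis
  proof (rule groupI)
    fix x assume "x \<in> carrier (Aut G)"
    then have "x \<in> carrier (AutoGroup G)" by (simp add: Aut_def)
    then show "\<exists>y\<in>carrier (Aut G). y \<otimes>\<^bsub>Aut G\<^esub> x = \<one>\<^bsub>Aut G\<^esub>"
      by (intro bexI [of _ "inv\<^bsub>AutoGroup G\<^esub> x"]) (auto simp: Aut_def)
  qed (auto simp: Aut_def A.m_assoc)
qed

lemma (in group) gconj_mult:
  "\<lbrakk>u \<in> carrier G; v \<in> carrier G; c \<in> carrier G\<rbrakk>
    \<Longrightarrow> gconj G (u \<otimes> v) c = gconj G u c \<otimes> gconj G v c"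
  using m_assoc [of c "inv c" "v \<otimes> c"] by (simp add: gconj_def m_assoc)

lemma (in group) gconj_gconj:
  "\<lbrakk>u \<in> carrier G; c \<in> carrier G; d \<in> carrier G\<rbrakk>
    \<Longrightarrow> gconj G (gconj G u c) d = gconj G u (c \<otimes> d)"
  by (simp add: gconj_def m_assoc inv_mult_group)

lemma (in group) gconj_one: "u \<in> carrier G \<Longrightarrow> gconj G u \<one> = u"
  by (simp add: gconj_def)

lemma (in group) inner_auto:
  assumes "c \<in> carrier G"
  shows "(\<lambda>u\<in>carrier G. gconj G u c) \<in> auto G"
proof -
  have "bij_betw (\<lambda>u. gconj G u c) (carrier G) (carrier G)"
    by (rule bij_betw_byWitness [of _ "\<lambda>u. gconj G u (inv c)"])
      (use assms in \<open>auto simp: gconj_gconj gconj_one\<close>)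
  then have "bij_betw (\<lambda>u\<in>carrier G. gconj G u c) (carrier G) (carrier G)"
    by simp
  then show ?thesis
    using assms by (auto simp: auto_def Bij_def hom_def gconj_mult)
qed

lemma (in group) normal_Inn: "Inn G \<lhd> Aut G"
proof -
  interpret A: group "Aut G" by (rule group_Aut)
  have inn_mult: "(\<lambda>u\<in>carrier G. gconj G u c) \<otimes>\<^bsub>Aut G\<^esub> (\<lambda>u\<in>carrier G. gconj G u d)
      = (\<lambda>u\<in>carrier G. gconj G u (c \<otimes> d))" if "c \<in> carrier G" "d \<in> carrier G" for c d
    using that by (auto simp: mult_Aut inner_auto gconj_gconj intro!: restrict_ext)
  have inn_inv: "inv\<^bsub>Aut G\<^esub> (\<lambda>u\<in>carrier G. gconj G u c) = (\<lambda>u\<in>carrier G. gconj G u (inv c))"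
    if "c \<in> carrier G" for c
    using that by (intro A.inv_equality)
      (auto simp: inn_mult carrier_Aut inner_auto one_Aut gconj_one intro!: restrict_ext)
  have "subgroup (Inn G) (Aut G)"
  proof (rule A.subgroupI)
    show "Inn G \<subseteq> carrier (Aut G)" by (auto simp: Inn_def carrier_Aut inner_auto)
    show "Inn G \<noteq> {}" by (auto simp: Inn_def)
  next
    fix a assume "a \<in> Inn G"
    then obtain c where "c \<in> carrier G" "a = (\<lambda>u\<in>carrier G. gconj G u c)"
      by (auto simp: Inn_def)
    then show "inv\<^bsub>Aut G\<^esub> a \<in> Inn G"
      using inn_inv [of c] inv_closed [of c] unfolding Inn_def by blast
  next
    fix a b assume "a \<in> Inn G" "b \<in> Inn G"
    then obtain c d where "c \<in> carrier G" "a = (\<lambda>u\<in>carrier G. gconj G u c)"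
      "d \<in> carrier G" "b = (\<lambda>u\<in>carrier G. gconj G u d)"
      by (auto simp: Inn_def)
    then show "a \<otimes>\<^bsub>Aut G\<^esub> b \<in> Inn G"
      using inn_mult [of c d] m_closed [of c d] unfolding Inn_def by blast
  qed
  moreover have "\<alpha> \<otimes>\<^bsub>Aut G\<^esub> \<beta> \<otimes>\<^bsub>Aut G\<^esub> inv\<^bsub>Aut G\<^esub> \<alpha> \<in> Inn G"
    if \<alpha>: "\<alpha> \<in> carrier (Aut G)" and "\<beta> \<in> Inn G" for \<alpha> \<beta>
  proof -
    obtain c where c: "c \<in> carrier G" and \<beta>: "\<beta> = (\<lambda>u\<in>carrier G. gconj G u c)"
      using \<open>\<beta> \<in> Inn G\<close> by (auto simp: Inn_def)
    define \<gamma> where "\<gamma> = inv\<^bsub>Aut G\<^esub> \<alpha>"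
    have \<gamma>: "\<gamma> \<in> carrier (Aut G)" using \<alpha> by (simp add: \<gamma>_def)
    have au: "\<alpha> \<in> auto G" "\<beta> \<in> auto G" "\<gamma> \<in> auto G"
      using \<alpha> \<gamma> c by (auto simp: carrier_Aut \<beta> inner_auto)
    have cl: "\<alpha> u \<in> carrier G" "\<gamma> u \<in> carrier G" if "u \<in> carrier G" for u
      using au that by (auto simp: auto_def hom_def)
    interpret \<gamma>: group_hom G G \<gamma> using au by unfold_locales (auto simp: auto_def)
    have "\<alpha> \<otimes>\<^bsub>Aut G\<^esub> \<gamma> = \<one>\<^bsub>Aut G\<^esub>" using \<alpha> by (simp add: \<gamma>_def)
    then have inv: "\<gamma> (\<alpha> u) = u" if "u \<in> carrier G" for u
      using that au by (auto simp: mult_Aut one_Aut dest: fun_cong [of _ _ u])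
    have "\<alpha> \<otimes>\<^bsub>Aut G\<^esub> \<beta> \<otimes>\<^bsub>Aut G\<^esub> \<gamma> = (\<lambda>u\<in>carrier G. gconj G u (\<gamma> c))"
    proof -
      have "\<alpha> \<otimes>\<^bsub>Aut G\<^esub> \<beta> \<in> auto G"
        using A.m_closed [of \<alpha> \<beta>] au by (simp add: carrier_Aut)
      then have "\<alpha> \<otimes>\<^bsub>Aut G\<^esub> \<beta> \<otimes>\<^bsub>Aut G\<^esub> \<gamma> = (\<lambda>u\<in>carrier G. \<gamma> (gconj G (\<alpha> u) c))"
        using au cl by (auto simp: mult_Aut \<beta> intro!: restrict_ext)
      also have "\<dots> = (\<lambda>u\<in>carrier G. gconj G u (\<gamma> c))"
        using c cl inv by (auto simp: gconj_def intro!: restrict_ext)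
      finally show ?thesis .
    qed
    then show ?thesis using c cl unfolding \<gamma>_def Inn_def by auto
  qed
  ultimately show ?thesis by (simp add: A.normal_inv_iff)
qed

lemma (in group) group_Out: "group (Out G)"
  unfolding Out_def by (rule normal.factorgroup_is_group [OF normal_Inn])


section \<open>Braid groups of closed orientable surfaces\<close>

definition handle_pair :: "nat \<Rightarrow> nat \<Rightarrow> bool"
  where "handle_pair s r \<longleftrightarrow> (\<exists>m::int. (int s, int r) = (2 * m - 1, 2 * m))"

text \<open>The word \<open>[a\<^sub>1\<inverse>, a\<^sub>2] [a\<^sub>3\<inverse>, a\<^sub>4] \<dots> [a\<^sub>2\<^sub>g\<^sub>-\<^sub>1\<inverse>, a\<^sub>2\<^sub>g]\<close>.\<close>

definition surface_word :: "('a, 'b) monoid_scheme \<Rightarrow> nat \<Rightarrow> (nat \<Rightarrow> 'a) \<Rightarrow> 'a"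
  where "surface_word G g a = gprod G (map (\<lambda>m. gcomm G (inv\<^bsub>G\<^esub> a (2 * m - 1)) (a (2 * m))) [1..<g + 1])"

datatype braid_letter = SigmaGen nat | XGen nat

definition braid_letters :: "nat \<Rightarrow> nat \<Rightarrow> braid_letter set"
  where "braid_letters m g = SigmaGen ` {1..m - 1} \<union> XGen ` {1..2 * g}"

text \<open>The relations of the braid group on \<open>m \<ge> 1\<close> strands of the surface of genus \<open>g \<ge> 1\<close>.
  On one strand this is the fundamental group of the surface.\<close>

definition braid_relations :: "nat \<Rightarrow> nat \<Rightarrow> (braid_letter word \<times> braid_letter word) set"
  where "braid_relations m g =
    (let F = free_group (braid_letters m g);
         \<sigma> = (\<lambda>i. free_gen (SigmaGen i));
         x = (\<lambda>r. free_gen (XGen r))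
     in if m = 1 then {(surface_word F g x, \<one>\<^bsub>F\<^esub>)}
        else
          {(\<sigma> i \<otimes>\<^bsub>F\<^esub> \<sigma> (i + 1) \<otimes>\<^bsub>F\<^esub> \<sigma> i, \<sigma> (i + 1) \<otimes>\<^bsub>F\<^esub> \<sigma> i \<otimes>\<^bsub>F\<^esub> \<sigma> (i + 1)) | i.
             1 \<le> i \<and> i + 1 \<le> m - 1}
        \<union> {(\<sigma> i \<otimes>\<^bsub>F\<^esub> \<sigma> j, \<sigma> j \<otimes>\<^bsub>F\<^esub> \<sigma> i) | i j.
             i \<in> {1..m - 1} \<and> j \<in> {1..m - 1} \<and> \<bar>int i - int j\<bar> > 1}
        \<union> {(x r \<otimes>\<^bsub>F\<^esub> \<sigma> i, \<sigma> i \<otimes>\<^bsub>F\<^esub> x r) | r i.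
             r \<in> {1..2 * g} \<and> i \<in> {1..m - 1} \<and> i \<noteq> 1}
        \<union> {((inv\<^bsub>F\<^esub> \<sigma> 1 \<otimes>\<^bsub>F\<^esub> x r \<otimes>\<^bsub>F\<^esub> inv\<^bsub>F\<^esub> \<sigma> 1) \<otimes>\<^bsub>F\<^esub> x r,
             x r \<otimes>\<^bsub>F\<^esub> (inv\<^bsub>F\<^esub> \<sigma> 1 \<otimes>\<^bsub>F\<^esub> x r \<otimes>\<^bsub>F\<^esub> inv\<^bsub>F\<^esub> \<sigma> 1)) | r.
             r \<in> {1..2 * g}}
        \<union> {((inv\<^bsub>F\<^esub> \<sigma> 1 \<otimes>\<^bsub>F\<^esub> x s \<otimes>\<^bsub>F\<^esub> \<sigma> 1) \<otimes>\<^bsub>F\<^esub> x r,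
             x r \<otimes>\<^bsub>F\<^esub> (inv\<^bsub>F\<^esub> \<sigma> 1 \<otimes>\<^bsub>F\<^esub> x s \<otimes>\<^bsub>F\<^esub> \<sigma> 1)) | s r.
             1 \<le> s \<and> s < r \<and> r \<le> 2 * g \<and> \<not> handle_pair s r}
        \<union> {((inv\<^bsub>F\<^esub> \<sigma> 1 \<otimes>\<^bsub>F\<^esub> x (2 * k - 1) \<otimes>\<^bsub>F\<^esub> inv\<^bsub>F\<^esub> \<sigma> 1) \<otimes>\<^bsub>F\<^esub> x (2 * k),
             x (2 * k) \<otimes>\<^bsub>F\<^esub> (inv\<^bsub>F\<^esub> \<sigma> 1 \<otimes>\<^bsub>F\<^esub> x (2 * k - 1) \<otimes>\<^bsub>F\<^esub> \<sigma> 1)) | k.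
             k \<in> {1..g}}
        \<union> {(surface_word F g x, gprod F (map \<sigma> ([1..<m] @ rev [1..<m])))})"

definition surface_braid_group :: "nat \<Rightarrow> nat \<Rightarrow> braid_letter word set monoid"
  where "surface_braid_group m g = presented_group (braid_letters m g) (braid_relations m g)"

definition braid_sigma :: "nat \<Rightarrow> nat \<Rightarrow> nat \<Rightarrow> braid_letter word set"
  where "braid_sigma m g k = presented_gen (braid_letters m g) (braid_relations m g) (SigmaGen k)"

definition braid_x :: "nat \<Rightarrow> nat \<Rightarrow> nat \<Rightarrow> braid_letter word set"
  where "braid_x m g r = presented_gen (braid_letters m g) (braid_relations m g) (XGen r)"

lemma (in group) surface_word_closed:
  assumes "\<And>r. r \<in> {1..2 * g} \<Longrightarrow> a r \<in> carrier G"
  shows "surface_word G g a \<in> carrier G"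
  unfolding surface_word_def by (rule gprod_closed) (auto intro!: gcomm_closed assms inv_closed)

lemma group_surface_braid_group:
  assumes "m \<ge> 1"
  shows "group (surface_braid_group m g)"
  unfolding surface_braid_group_def
proof (rule group_presented_group)
  interpret F: group "free_group (braid_letters m g)" by (rule group_free_group)
  have s: "free_gen (SigmaGen i) \<in> carrier (free_group (braid_letters m g))"
    if "1 \<le> i" "i \<le> m - 1" for i
    using that by (auto simp: braid_letters_def)
  have x: "free_gen (XGen r) \<in> carrier (free_group (braid_letters m g))"
    if "1 \<le> r" "r \<le> 2 * g" for r
    using that by (auto simp: braid_letters_def)
  have "surface_word (free_group (braid_letters m g)) g (\<lambda>r. free_gen (XGen r))
      \<in> carrier (free_group (braid_letters m g))"
    by (rule F.surface_word_closed) (auto intro: x)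
  moreover have "gprod (free_group (braid_letters m g))
      (map (\<lambda>i. free_gen (SigmaGen i)) ([1..<m] @ rev [1..<m]))
      \<in> carrier (free_group (braid_letters m g))"
    by (rule F.gprod_closed) (auto intro!: s)
  ultimately show "braid_relations m g \<subseteq>
      carrier (free_group (braid_letters m g)) \<times> carrier (free_group (braid_letters m g))"
    using assms unfolding braid_relations_def Let_def
    by (auto intro!: F.m_closed F.inv_closed s x)
qed


section \<open>The free group acted upon\<close>

datatype V_letter = TauGen nat | WGen nat

definition V_group :: "nat \<Rightarrow> nat \<Rightarrow> V_letter word monoid"
  where "V_group m g = free_group (TauGen ` {2..m} \<union> WGen ` {1..2 * g})"

definition w_gen :: "nat \<Rightarrow> V_letter word"
  where "w_gen r = free_gen (WGen r)"

text \<open>For \<open>i = 1\<close> this is not a basis element but the word making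
  \<open>\<tau>\<^sub>1 \<tau>\<^sub>2 \<dots> \<tau>\<^sub>m\<close> equal to the surface word in the \<open>w\<^sub>r\<close>.\<close>

definition tau :: "nat \<Rightarrow> nat \<Rightarrow> nat \<Rightarrow> V_letter word"
  where "tau m g i = (if i = 1
    then surface_word (V_group m g) g w_gen
      \<otimes>\<^bsub>V_group m g\<^esub> gprod (V_group m g) (map (\<lambda>j. inv\<^bsub>V_group m g\<^esub> free_gen (TauGen j)) (rev [2..<m + 1]))
    else free_gen (TauGen i))"

end

theory Submission
  imports Defs
begin

text \<open>Write \<open>t = \<tau>\<^sub>1\<close> and let \<open>W\<close> be the surface word in the \<open>w\<^sub>p\<close>, so that \<open>W = \<tau>\<^sub>1 \<dots> \<tau>\<^sub>m\<close>.
  The automorphism for \<open>x\<^sub>r\<close> multiplies the two ends of every loop \<open>w\<^sub>p\<close> by \<open>1\<close>, \<open>t\<close> or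
  \<open>D = [w\<^sub>r\<inverse>, t]\<close>, according to the position of the end relative to the loop \<open>w\<^sub>r\<close>. It therefore
  maps \<open>W\<close> to \<open>D\<inverse> W\<close> and \<open>t\<close> to \<open>D\<inverse> t\<close>, which is (S7), and its inverse is a map of the same
  shape with \<open>w\<^sub>r\<inverse> t\<inverse> w\<^sub>r\<close> in the place of \<open>t\<close>. The automorphism for \<open>\<sigma>\<^sub>k\<close> fixes \<open>W\<close> and hence acts
  on all of \<open>\<tau>\<^sub>1, \<dots>, \<tau>\<^sub>m\<close> by one formula. All relations of the braid group but the last hold
  already for these automorphisms, by free reduction on the basis. As for the last one,
  \<open>[x\<^sub>1\<inverse>, x\<^sub>2] \<dots> [x\<^sub>2\<^sub>k\<^sub>-\<^sub>1\<inverse>, x\<^sub>2\<^sub>k]\<close> conjugates \<open>w\<^sub>1, \<dots>, w\<^sub>2\<^sub>k\<close> by \<open>t\<close> and fixes the other basis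
  elements, while \<open>\<sigma>\<^sub>1 \<dots> \<sigma>\<^sub>m\<^sub>-\<^sub>1\<^sup>2 \<dots> \<sigma>\<^sub>1\<close> fixes every \<open>w\<^sub>p\<close> and conjugates every \<open>\<tau>\<^sub>i\<close> with \<open>i \<ge> 2\<close>
  by \<open>t\<inverse>\<close>. For \<open>k = g\<close> the two differ by the conjugation by \<open>t\<close>.\<close>

section \<open>Words in groups and homomorphisms\<close>

context group
begin

lemma mult_inv_cancel: "\<lbrakk>x \<in> carrier G; y \<in> carrier G\<rbrakk> \<Longrightarrow> x \<otimes> (inv x \<otimes> y) = y"
  by (simp add: m_assoc [symmetric])

lemma inv_mult_cancel: "\<lbrakk>x \<in> carrier G; y \<in> carrier G\<rbrakk> \<Longrightarrow> inv x \<otimes> (x \<otimes> y) = y"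
  by (simp add: m_assoc [symmetric])

text \<open>Together with the cancellation of adjacent inverse letters these rules perform free
  reduction: products associate to the right and inverses move to the letters. Equal words in a
  basis thereby reach the same normal form.\<close>

lemmas word_simps = m_assoc inv_mult_group mult_inv_cancel inv_mult_cancel gconj_def gcomm_def

lemma gprod_Nil [simp]: "gprod G [] = \<one>"
  by (simp add: gprod_def)

lemma gprod_Cons [simp]: "gprod G (x # xs) = x \<otimes> gprod G xs"
  by (simp add: gprod_def)

lemma gprod_append:
  "\<lbrakk>set xs \<subseteq> carrier G; set ys \<subseteq> carrier G\<rbrakk> \<Longrightarrow> gprod G (xs @ ys) = gprod G xs \<otimes> gprod G ys"
  by (induction xs) (auto simp: m_assoc)

lemma surface_word_0 [simp]: "surface_word G 0 a = \<one>"
  by (simp add: surface_word_def)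

lemma surface_word_Suc:
  assumes "\<And>r. r \<in> {1..2 * Suc k} \<Longrightarrow> a r \<in> carrier G"
  shows "surface_word G (Suc k) a
    = surface_word G k a \<otimes> gcomm G (inv (a (2 * k + 1))) (a (2 * k + 2))"
proof -
  have cl: "a (2 * j - 1) \<in> carrier G" "a (2 * j) \<in> carrier G" if "1 \<le> j" "j \<le> Suc k" for j
    using that by (auto intro!: assms)
  have "surface_word G (Suc k) a
      = gprod G (map (\<lambda>j. gcomm G (inv (a (2 * j - 1))) (a (2 * j))) [1..<k + 1])
        \<otimes> gprod G [gcomm G (inv (a (2 * k + 1))) (a (2 * k + 2))]"
    unfolding surface_word_def
    using cl [of "Suc k"] by (subst gprod_append [symmetric]) (auto intro!: gcomm_closed cl [simplified])
  then show ?thesis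
    using cl [of "Suc k"] by (simp add: surface_word_def)
qed

lemma surface_word_cong:
  assumes "\<And>r. r \<in> {1..2 * k} \<Longrightarrow> a r = b r"
  shows "surface_word G k a = surface_word G k b"
proof -
  have "a (2 * j - 1) = b (2 * j - 1)" "a (2 * j) = b (2 * j)" if "1 \<le> j" "j \<le> k" for j
    using that by (auto intro!: assms)
  then show ?thesis
    unfolding surface_word_def by (auto intro!: arg_cong [of _ _ "gprod G"])
qed

section \<open>Endomorphisms, automorphisms and outer classes\<close>

lemma endo_inv: "\<lbrakk>h \<in> hom G G; x \<in> carrier G\<rbrakk> \<Longrightarrow> h (inv x) = inv (h x)"
  using group_hom.hom_inv [of G G h] by (simp add: group_hom_def group_hom_axioms_def is_group)

lemma endo_one: "h \<in> hom G G \<Longrightarrow> h \<one> = \<one>"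
  by (rule hom_one) (auto simp: is_group)

lemma autoI:
  assumes "h \<in> hom G G" "h \<in> extensional (carrier G)" "k \<in> hom G G"
    and "\<And>u. u \<in> carrier G \<Longrightarrow> k (h u) = u" "\<And>u. u \<in> carrier G \<Longrightarrow> h (k u) = u"
  shows "h \<in> auto G"
proof -
  have "bij_betw h (carrier G) (carrier G)"
    by (rule bij_betw_byWitness [of _ k]) (use assms in \<open>auto simp: hom_def\<close>)
  then show ?thesis
    using assms by (simp add: auto_def Bij_def)
qed

lemma out_class_hom: "out_class G \<in> hom (Aut G) (Out G)"
proof -
  have "out_class G = (\<lambda>\<alpha>. Inn G #>\<^bsub>Aut G\<^esub> \<alpha>)"
    by (simp add: out_class_def fun_eq_iff)
  then show ?thesis
    using normal.r_coset_hom_Mod [OF normal_Inn] by (simp add: Out_def)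
qed

text \<open>An inner automorphism has trivial outer class. This absorbs the conjugation by which the
  two sides of the surface relation differ.\<close>

lemma out_class_mult_Inn:
  assumes "\<alpha> \<in> auto G" "\<beta> \<in> Inn G"
  shows "out_class G (\<alpha> \<otimes>\<^bsub>Aut G\<^esub> \<beta>) = out_class G \<alpha>"
proof -
  interpret A: group "Aut G" by (rule group_Aut)
  interpret O: group "Out G" by (rule group_Out)
  interpret N: normal "Inn G" "Aut G" by (rule normal_Inn)
  have "out_class G \<beta> = \<one>\<^bsub>Out G\<^esub>"
    using A.coset_join2 [OF N.mem_carrier [OF assms(2)] N.subgroup_axioms assms(2)]
    by (simp add: out_class_def Out_def FactGroup_def)
  moreover have "out_class G \<alpha> \<in> carrier (Out G)"
    using hom_in_carrier [OF out_class_hom] assms by (simp add: carrier_Aut)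
  ultimately show ?thesis
    using hom_mult [OF out_class_hom] assms N.mem_carrier by (simp add: carrier_Aut)
qed

end

context group_hom
begin

lemma hom_gprod: "set xs \<subseteq> carrier G \<Longrightarrow> h (gprod G xs) = gprod H (map h xs)"
  by (induction xs) auto

lemma hom_gcomm: "\<lbrakk>a \<in> carrier G; b \<in> carrier G\<rbrakk> \<Longrightarrow> h (gcomm G a b) = gcomm H (h a) (h b)"
  by (simp add: gcomm_def)

lemma hom_gconj: "\<lbrakk>a \<in> carrier G; b \<in> carrier G\<rbrakk> \<Longrightarrow> h (gconj G a b) = gconj H (h a) (h b)"
  by (simp add: gconj_def)

lemma hom_surface_word:
  assumes "\<And>r. r \<in> {1..2 * k} \<Longrightarrow> a r \<in> carrier G"
  shows "h (surface_word G k a) = surface_word H k (\<lambda>r. h (a r))"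
proof -
  have cl: "a (2 * j - 1) \<in> carrier G" "a (2 * j) \<in> carrier G" if "1 \<le> j" "j \<le> k" for j
    using that by (auto intro!: assms)
  then show ?thesis
    unfolding surface_word_def
    by (subst hom_gprod) (auto simp: hom_gcomm intro!: arg_cong [of _ _ "gprod H"])
qed

end

section \<open>Homomorphisms out of groups given by generators and relations\<close>

lemma normal_closure_le_kernel:
  assumes "group_hom G H h" "R \<subseteq> kernel G H h"
  shows "normal_closure G R \<subseteq> kernel G H h"
  using group_hom.normal_kernel [OF assms(1)] assms(2) unfolding normal_closure_def by blast

text \<open>Von Dyck's theorem: the kernel of \<open>h\<close> is normal and contains the quotient
  of the two sides of every relation, hence the normal closure of these quotients, so that
  \<open>h\<close> factors through the presented group.\<close>

lemma presented_group_hom: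
  assumes "group H" and h: "h \<in> hom (free_group S) H"
    and R: "R \<subseteq> carrier (free_group S) \<times> carrier (free_group S)"
    and rel: "\<And>u v. (u, v) \<in> R \<Longrightarrow> h u = h v"
  obtains \<rho> where "\<rho> \<in> hom (presented_group S R) H"
    "\<And>a. a \<in> S \<Longrightarrow> \<rho> (presented_gen S R a) = h (free_gen a)"
proof -
  interpret F: group "free_group S" by (rule group_free_group)
  interpret H: group H by fact
  interpret h: group_hom "free_group S" H h
    using h by unfold_locales
  let ?U = "{u \<otimes>\<^bsub>free_group S\<^esub> inv\<^bsub>free_group S\<^esub> v | u v. (u, v) \<in> R}"
  have "?U \<subseteq> kernel (free_group S) H h"
  proof clarify
    fix u v assume uv: "(u, v) \<in> R"
    then have "u \<in> carrier (free_group S)" "v \<in> carrier (free_group S)"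
      using R by auto
    then show "u \<otimes>\<^bsub>free_group S\<^esub> inv\<^bsub>free_group S\<^esub> v \<in> kernel (free_group S) H h"
      by (simp add: kernel_def rel [OF uv])
  qed
  then have "relation_subgroup S R \<subseteq> kernel (free_group S) H h"
    unfolding relation_subgroup_def by (intro normal_closure_le_kernel h.group_hom_axioms)
  moreover have "relation_subgroup S R \<lhd> free_group S"
    unfolding relation_subgroup_def using R by (intro F.normal_closure_normal) auto
  ultimately obtain \<rho> where "\<rho> \<in> hom (free_group S Mod relation_subgroup S R) H"
    "\<And>u. u \<in> carrier (free_group S) \<Longrightarrow> \<rho> (relation_subgroup S R #>\<^bsub>free_group S\<^esub> u) = h u"
    using h.FactGroup_universal_kernel by metis
  then show thesis
    by (intro that [of \<rho>]) (simp_all add: presented_group_def presented_gen_def)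
qed

section \<open>The free group acted upon\<close>

text \<open>The parity form makes visible that an index belongs to at most one pair; the exclusions
  in the later case distinctions rest on this.\<close>

lemma handle_pair_iff: "handle_pair s r \<longleftrightarrow> odd s \<and> r = Suc s"
proof
  assume "handle_pair s r"
  then obtain m :: int where m: "int s = 2 * m - 1" "int r = 2 * m"
    by (auto simp: handle_pair_def)
  then have "r = Suc s" "odd (int s)" by auto
  then show "odd s \<and> r = Suc s" by simp
next
  assume "odd s \<and> r = Suc s"
  then obtain k where "s = 2 * k + 1" "r = Suc s" by (metis oddE)
  then show "handle_pair s r"
    unfolding handle_pair_def by (intro exI [of _ "int k + 1"]) auto
qed

text \<open>Only the universal property of the basis and the formula for \<open>\<tau> 1\<close> are
  recorded, so all computations are independent of reduced words. Uniqueness is stated for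
  extensional maps because a homomorphism is unconstrained off the carrier.\<close>

locale surface_free_group = group G for G (structure) +
  fixes m g :: nat and \<tau> w :: "nat \<Rightarrow> 'a"
  assumes m_ge_1: "m \<ge> 1"
    and tau_basis_closed: "i \<in> {2..m} \<Longrightarrow> \<tau> i \<in> carrier G"
    and w_closed: "r \<in> {1..2 * g} \<Longrightarrow> w r \<in> carrier G"
    and tau_1_eq: "\<tau> 1 = surface_word G g w \<otimes> gprod G (map (\<lambda>j. inv (\<tau> j)) (rev [2..<m + 1]))"
    and universal: "\<lbrakk>a \<in> {2..m} \<rightarrow> carrier G; b \<in> {1..2 * g} \<rightarrow> carrier G\<rbrakk>
      \<Longrightarrow> \<exists>!h. h \<in> hom G G \<inter> extensional (carrier G)
        \<and> (\<forall>i\<in>{2..m}. h (\<tau> i) = a i) \<and> (\<forall>r\<in>{1..2 * g}. h (w r) = b r)"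
begin

declare One_nat_def [simp del]

lemma one_le_Suc [simp]: "1 \<le> Suc n"
  by (simp add: One_nat_def)

definition t :: 'a
  where "t = \<tau> 1"

text \<open>The inverse of the product of \<open>\<tau> 2\<close> up to
  \<open>\<tau> (j - 1)\<close>. The tail of \<open>\<tau> 1\<close> is \<open>T (m + 1)\<close>;
  the shorter products serve inductions on \<open>j\<close>.\<close>

definition T :: "nat \<Rightarrow> 'a"
  where "T j = gprod G (map (\<lambda>i. inv (\<tau> i)) (rev [2..<j]))"

definition endo :: "(nat \<Rightarrow> 'a) \<Rightarrow> (nat \<Rightarrow> 'a) \<Rightarrow> 'a \<Rightarrow> 'a"
  where "endo a b = (THE h. h \<in> hom G G \<inter> extensional (carrier G)
    \<and> (\<forall>i\<in>{2..m}. h (\<tau> i) = a i) \<and> (\<forall>r\<in>{1..2 * g}. h (w r) = b r))"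

lemma w_cl [simp]: "1 \<le> r \<Longrightarrow> r \<le> 2 * g \<Longrightarrow> w r \<in> carrier G"
  using w_closed by simp

lemma surface_w_closed [simp]: "k \<le> g \<Longrightarrow> surface_word G k w \<in> carrier G"
  by (rule surface_word_closed) (auto intro: w_closed)

lemma T_closed [simp]: "j \<le> m + 1 \<Longrightarrow> T j \<in> carrier G"
  unfolding T_def by (rule gprod_closed) (auto intro!: inv_closed tau_basis_closed)

lemma T_2 [simp]: "T 2 = \<one>"
  by (simp add: T_def)

lemma T_Suc: "2 \<le> j \<Longrightarrow> T (Suc j) = inv (\<tau> j) \<otimes> T j"
  by (simp add: T_def)

lemma t_eq: "t = surface_word G g w \<otimes> T (m + 1)"
  by (simp add: t_def T_def tau_1_eq)

lemma t_closed [simp]: "t \<in> carrier G"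
  by (simp add: t_eq)

lemma tau_cl [simp]: "1 \<le> i \<Longrightarrow> i \<le> m \<Longrightarrow> \<tau> i \<in> carrier G"
  using t_closed tau_basis_closed [of i] by (cases "i = 1") (auto simp: t_def)

lemma endo:
  assumes "\<And>i. i \<in> {2..m} \<Longrightarrow> a i \<in> carrier G" "\<And>r. r \<in> {1..2 * g} \<Longrightarrow> b r \<in> carrier G"
  shows endo_hom: "endo a b \<in> hom G G"
    and endo_extensional: "endo a b \<in> extensional (carrier G)"
    and endo_tau: "\<And>i. i \<in> {2..m} \<Longrightarrow> endo a b (\<tau> i) = a i"
    and endo_w: "\<And>r. r \<in> {1..2 * g} \<Longrightarrow> endo a b (w r) = b r"
proof -
  have "endo a b \<in> hom G G \<inter> extensional (carrier G)
    \<and> (\<forall>i\<in>{2..m}. endo a b (\<tau> i) = a i) \<and> (\<forall>r\<in>{1..2 * g}. endo a b (w r) = b r)"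
    unfolding endo_def by (rule theI' [OF universal]) (use assms in auto)
  then show "endo a b \<in> hom G G" "endo a b \<in> extensional (carrier G)"
    "\<And>i. i \<in> {2..m} \<Longrightarrow> endo a b (\<tau> i) = a i" "\<And>r. r \<in> {1..2 * g} \<Longrightarrow> endo a b (w r) = b r"
    by auto
qed

lemma hom_eqI:
  assumes h: "h \<in> hom G G" and k: "k \<in> hom G G"
    and \<tau>: "\<And>i. i \<in> {2..m} \<Longrightarrow> h (\<tau> i) = k (\<tau> i)"
    and w: "\<And>r. r \<in> {1..2 * g} \<Longrightarrow> h (w r) = k (w r)"
    and u: "u \<in> carrier G"
  shows "h u = k u"
proof -
  define P where "P f \<longleftrightarrow> f \<in> hom G G \<inter> extensional (carrier G)
    \<and> (\<forall>i\<in>{2..m}. f (\<tau> i) = k (\<tau> i)) \<and> (\<forall>r\<in>{1..2 * g}. f (w r) = k (w r))" for f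
  have ex1: "\<exists>!f. P f"
    unfolding P_def
  proof (rule universal)
    show "(\<lambda>i. k (\<tau> i)) \<in> {2..m} \<rightarrow> carrier G" "(\<lambda>r. k (w r)) \<in> {1..2 * g} \<rightarrow> carrier G"
      using hom_in_carrier [OF k] tau_basis_closed w_closed by blast+
  qed
  \<comment> \<open>The universal property compares extensional maps only, so the given
    homomorphisms are replaced by their restrictions to the carrier.\<close>
  have P: "P (restrict f (carrier G))"
    if f: "f \<in> hom G G" and "\<forall>i\<in>{2..m}. f (\<tau> i) = k (\<tau> i)"
      "\<forall>r\<in>{1..2 * g}. f (w r) = k (w r)" for f
  proof -
    have "restrict f (carrier G) \<in> hom G G"
      using f by (simp add: hom_def Pi_iff)
    then show ?thesis
      unfolding P_def using that tau_basis_closed w_closed by simp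
  qed
  have "restrict h (carrier G) = restrict k (carrier G)"
    using ex1 P [OF h] P [OF k] \<tau> w by blast
  then have "restrict h (carrier G) u = restrict k (carrier G) u" by simp
  then show ?thesis
    using u by simp
qed

lemma id_endo: "id \<in> hom G G"
  by (simp add: hom_def)

text \<open>Uniqueness of extensions, applied to the composite and the identity, reduces
  invertibility to a calculation on basis elements.\<close>

lemma inverse_on_basis:
  assumes h: "h \<in> hom G G" and k: "k \<in> hom G G"
    and "\<And>i. \<lbrakk>2 \<le> i; i \<le> m\<rbrakk> \<Longrightarrow> k (h (\<tau> i)) = \<tau> i"
    and "\<And>r. \<lbrakk>1 \<le> r; r \<le> 2 * g\<rbrakk> \<Longrightarrow> k (h (w r)) = w r"
    and u: "u \<in> carrier G"
  shows "k (h u) = u"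
  using hom_eqI [OF hom_compose [OF h k] id_endo _ _ u] assms
  by (simp add: compose_eq)

lemma auto_eqI:
  assumes "\<alpha> \<in> auto G" "\<beta> \<in> auto G"
    and "\<And>i. i \<in> {2..m} \<Longrightarrow> \<alpha> (\<tau> i) = \<beta> (\<tau> i)" "\<And>r. r \<in> {1..2 * g} \<Longrightarrow> \<alpha> (w r) = \<beta> (w r)"
  shows "\<alpha> = \<beta>"
proof (rule extensionalityI [of _ "carrier G"])
  show "\<alpha> \<in> extensional (carrier G)" "\<beta> \<in> extensional (carrier G)"
    using assms by (auto simp: auto_def Bij_def)
  show "\<alpha> u = \<beta> u" if "u \<in> carrier G" for u
    by (rule hom_eqI [OF _ _ assms(3,4) that]) (use assms in \<open>auto simp: auto_def\<close>)
qed

section \<open>The generators\<close>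

text \<open>The Artin action, which preserves \<open>\<tau> k \<otimes> \<tau> (Suc k)\<close>. For
  \<open>k = 1\<close> the first case concerns no basis element; that \<open>\<tau> 1\<close> obeys
  it too has to be derived.\<close>

definition sig :: "nat \<Rightarrow> 'a \<Rightarrow> 'a"
  where "sig k = endo (\<lambda>l. if l = k then \<tau> k \<otimes> \<tau> (Suc k) \<otimes> inv (\<tau> k)
    else if l = Suc k then \<tau> k else \<tau> l) w"

definition sig_inv :: "nat \<Rightarrow> 'a \<Rightarrow> 'a"
  where "sig_inv k = endo (\<lambda>l. if l = k then \<tau> (Suc k)
    else if l = Suc k then inv (\<tau> (Suc k)) \<otimes> \<tau> k \<otimes> \<tau> (Suc k) else \<tau> l) w"

text \<open>The parameter \<open>u\<close> stays free so that one computation of the image of the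
  surface word covers both \<open>X\<close> and \<open>X_inv\<close>.\<close>

definition twist_image :: "nat \<Rightarrow> 'a \<Rightarrow> nat \<Rightarrow> 'a"
  where "twist_image r u p = (if p < r then inv (gcomm G (inv (w r)) u) \<otimes> w p \<otimes> (if handle_pair p r then u else gcomm G (inv (w r)) u)
    else if p = r then inv u \<otimes> w r \<otimes> u
    else if handle_pair r p then inv u \<otimes> w p else w p)"

definition twist :: "nat \<Rightarrow> 'a \<Rightarrow> 'a \<Rightarrow> 'a"
  where "twist r u = endo \<tau> (twist_image r u)"

definition X :: "nat \<Rightarrow> 'a \<Rightarrow> 'a"
  where "X r = twist r t"

text \<open>\<open>X r\<close> sends the element substituted for \<open>u\<close> to
  \<open>inv t\<close>, hence the commutator formed with it to the inverse of the one formed with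
  \<open>t\<close>. The factors at the two ends of every loop therefore cancel.\<close>

definition X_inv :: "nat \<Rightarrow> 'a \<Rightarrow> 'a"
  where "X_inv r = twist r (inv (w r) \<otimes> inv t \<otimes> w r)"

lemma sig_hom: "1 \<le> k \<Longrightarrow> k < m \<Longrightarrow> sig k \<in> hom G G"
  and sig_inv_hom: "1 \<le> k \<Longrightarrow> k < m \<Longrightarrow> sig_inv k \<in> hom G G"
  and sig_extensional: "1 \<le> k \<Longrightarrow> k < m \<Longrightarrow> sig k \<in> extensional (carrier G)"
  and sig_inv_extensional: "1 \<le> k \<Longrightarrow> k < m \<Longrightarrow> sig_inv k \<in> extensional (carrier G)"
  unfolding sig_def sig_inv_def by (rule endo_hom endo_extensional; simp)+

lemma sig_w [simp]: "\<lbrakk>1 \<le> k; k < m; 1 \<le> r; r \<le> 2 * g\<rbrakk> \<Longrightarrow> sig k (w r) = w r"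
  and sig_inv_w [simp]: "\<lbrakk>1 \<le> k; k < m; 1 \<le> r; r \<le> 2 * g\<rbrakk> \<Longrightarrow> sig_inv k (w r) = w r"
  unfolding sig_def sig_inv_def by (rule endo_w; simp)+

lemma sig_tau_basis: "\<lbrakk>1 \<le> k; k < m; 2 \<le> l; l \<le> m\<rbrakk> \<Longrightarrow> sig k (\<tau> l) =
    (if l = k then \<tau> k \<otimes> \<tau> (Suc k) \<otimes> inv (\<tau> k) else if l = Suc k then \<tau> k else \<tau> l)"
  unfolding sig_def by (rule endo_tau; simp)

lemma sig_inv_tau_basis: "\<lbrakk>1 \<le> k; k < m; 2 \<le> l; l \<le> m\<rbrakk> \<Longrightarrow> sig_inv k (\<tau> l) =
    (if l = k then \<tau> (Suc k) else if l = Suc k then inv (\<tau> (Suc k)) \<otimes> \<tau> k \<otimes> \<tau> (Suc k) else \<tau> l)"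
  unfolding sig_inv_def by (rule endo_tau; simp)

text \<open>The surface word \<open>t T\<^sup>-\<^sup>1\<close> is fixed, so the image of \<open>t\<close> is read off from that of \<open>T\<close>.\<close>

lemma hom_t_fixed:
  assumes h: "h \<in> hom G G" and k: "2 \<le> k" "k < m"
    and w: "\<And>r. r \<in> {1..2 * g} \<Longrightarrow> h (w r) = w r"
    and \<tau>: "\<And>l. \<lbrakk>2 \<le> l; l \<le> m; l \<noteq> k; l \<noteq> Suc k\<rbrakk> \<Longrightarrow> h (\<tau> l) = \<tau> l"
    and k_Suc: "h (\<tau> k) \<otimes> h (\<tau> (Suc k)) = \<tau> k \<otimes> \<tau> (Suc k)"
  shows "h t = t"
proof -
  interpret h: group_hom G G h using h by unfold_locales
  have below: "h (T j) = T j" if "2 \<le> j" "j \<le> k" for j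
    using that
  proof (induction j rule: dec_induct)
    case (step j)
    then show ?case using k by (simp add: T_Suc \<tau>)
  qed simp
  \<comment> \<open>The two moved letters occur in \<open>T (k + 2)\<close> as one adjacent block,
    whose product \<open>h\<close> preserves.\<close>
  have "h (T (k + 2)) = inv (h (\<tau> k) \<otimes> h (\<tau> (Suc k))) \<otimes> h (T k)"
    using k by (simp add: T_Suc word_simps)
  also have "\<dots> = T (k + 2)"
    using k below by (simp only: k_Suc) (simp add: T_Suc word_simps)
  finally have base: "h (T (k + 2)) = T (k + 2)" .
  have "h (T j) = T j" if "k + 2 \<le> j" "j \<le> m + 1" for j
    using that
  proof (induction j rule: dec_induct)
    case (step j)
    then show ?case using k by (simp add: T_Suc \<tau>)
  qed (rule base)
  then have "h (T (m + 1)) = T (m + 1)" using k by simp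
  moreover have "h (surface_word G g w) = surface_word G g w"
    by (subst h.hom_surface_word) (auto intro!: w_closed surface_word_cong w)
  ultimately show ?thesis by (simp add: t_eq)
qed

text \<open>The surface word and the letters from \<open>\<tau> 3\<close> on are fixed, so the
  product \<open>t \<otimes> \<tau> 2\<close> is fixed as well; the formula solves this for the
  image of \<open>t\<close>.\<close>

lemma hom_t_moved:
  assumes h: "h \<in> hom G G" and m: "2 \<le> m"
    and w: "\<And>r. r \<in> {1..2 * g} \<Longrightarrow> h (w r) = w r"
    and \<tau>: "\<And>l. \<lbrakk>3 \<le> l; l \<le> m\<rbrakk> \<Longrightarrow> h (\<tau> l) = \<tau> l"
  shows "h t = t \<otimes> \<tau> 2 \<otimes> inv (h (\<tau> 2))"
proof -
  interpret h: group_hom G G h using h by unfold_locales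
  have "h (T j) = T j \<otimes> \<tau> 2 \<otimes> inv (h (\<tau> 2))" if "3 \<le> j" "j \<le> m + 1" for j
    using that
  proof (induction j rule: dec_induct)
    case base
    show ?case using m T_Suc [of 2] by (simp add: word_simps)
  next
    case (step j)
    then show ?case using m by (simp add: T_Suc \<tau> word_simps)
  qed
  then have "h (T (m + 1)) = T (m + 1) \<otimes> \<tau> 2 \<otimes> inv (h (\<tau> 2))" using m by simp
  moreover have "h (surface_word G g w) = surface_word G g w"
    by (subst h.hom_surface_word) (auto intro!: w_closed surface_word_cong w)
  ultimately show ?thesis using m by (simp add: t_eq word_simps)
qed

lemma sig_t: "\<lbrakk>1 \<le> k; k < m\<rbrakk> \<Longrightarrow> sig k t = (if k = 1 then t \<otimes> \<tau> 2 \<otimes> inv t else t)"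
  using hom_t_moved [OF sig_hom, of 1] hom_t_fixed [OF sig_hom, of k k]
  by (auto simp: sig_tau_basis word_simps t_def)

lemma sig_inv_t: "\<lbrakk>1 \<le> k; k < m\<rbrakk> \<Longrightarrow> sig_inv k t = (if k = 1 then \<tau> 2 else t)"
  using hom_t_moved [OF sig_inv_hom, of 1] hom_t_fixed [OF sig_inv_hom, of k k]
  by (auto simp: sig_inv_tau_basis word_simps t_def)

text \<open>Once the image of \<open>t\<close> is known, the formula on the basis extends to
  \<open>l = 1\<close>. Computations with several \<open>sig k\<close> can then treat all
  \<open>\<tau> l\<close> alike.\<close>

lemma sig_tau: "\<lbrakk>1 \<le> k; k < m; 1 \<le> l; l \<le> m\<rbrakk> \<Longrightarrow> sig k (\<tau> l) =
    (if l = k then \<tau> k \<otimes> \<tau> (Suc k) \<otimes> inv (\<tau> k) else if l = Suc k then \<tau> k else \<tau> l)"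
  using sig_tau_basis [of k l] sig_t [of k] by (cases "l = 1") (auto simp: t_def)

lemma sig_inv_tau: "\<lbrakk>1 \<le> k; k < m; 1 \<le> l; l \<le> m\<rbrakk> \<Longrightarrow> sig_inv k (\<tau> l) =
    (if l = k then \<tau> (Suc k) else if l = Suc k then inv (\<tau> (Suc k)) \<otimes> \<tau> k \<otimes> \<tau> (Suc k) else \<tau> l)"
  using sig_inv_tau_basis [of k l] sig_inv_t [of k] by (cases "l = 1") (auto simp: t_def)

lemma sig_auto: "\<lbrakk>1 \<le> k; k < m\<rbrakk> \<Longrightarrow> sig k \<in> auto G"
  and sig_inv_auto: "\<lbrakk>1 \<le> k; k < m\<rbrakk> \<Longrightarrow> sig_inv k \<in> auto G"
  and sig_sig_inv: "\<lbrakk>1 \<le> k; k < m; u \<in> carrier G\<rbrakk> \<Longrightarrow> sig k (sig_inv k u) = u"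
proof -
  assume k: "1 \<le> k" "k < m"
  note s = sig_hom [OF k] and s' = sig_inv_hom [OF k]
  have 1: "sig k (sig_inv k u) = u" if "u \<in> carrier G" for u
    using inverse_on_basis [OF s' s _ _ that] k
    by (auto simp: sig_tau sig_inv_tau hom_mult [OF s] endo_inv [OF s] word_simps)
  have 2: "sig_inv k (sig k u) = u" if "u \<in> carrier G" for u
    using inverse_on_basis [OF s s' _ _ that] k
    by (auto simp: sig_tau sig_inv_tau hom_mult [OF s'] endo_inv [OF s'] word_simps)
  show "sig k \<in> auto G" "sig_inv k \<in> auto G"
    by (rule autoI [OF s sig_extensional s' 2 1] autoI [OF s' sig_inv_extensional s 1 2]; use k in simp)+
  show "u \<in> carrier G \<Longrightarrow> sig k (sig_inv k u) = u" by (rule 1)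
qed


section \<open>Images of the surface word and of \<open>t\<close> under a twist\<close>

context
  fixes r u
  assumes r: "1 \<le> r" "r \<le> 2 * g" and u: "u \<in> carrier G"
begin

lemma twist_image_closed:
  "p \<in> {1..2 * g} \<Longrightarrow> twist_image r u p \<in> carrier G"
  using r u by (simp add: twist_image_def)

lemma twist_hom: "twist r u \<in> hom G G"
  and twist_extensional: "twist r u \<in> extensional (carrier G)"
  and twist_tau: "\<lbrakk>2 \<le> l; l \<le> m\<rbrakk> \<Longrightarrow> twist r u (\<tau> l) = \<tau> l"
  and twist_w: "\<lbrakk>1 \<le> p; p \<le> 2 * g\<rbrakk> \<Longrightarrow> twist r u (w p) = twist_image r u p"
proof -
  note e = endo [OF tau_basis_closed twist_image_closed]
  show "twist r u \<in> hom G G" "twist r u \<in> extensional (carrier G)"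
    unfolding twist_def by (rule e(1,2); assumption)+
  show "\<lbrakk>2 \<le> l; l \<le> m\<rbrakk> \<Longrightarrow> twist r u (\<tau> l) = \<tau> l"
    unfolding twist_def by (rule e(3)) auto
  show "\<lbrakk>1 \<le> p; p \<le> 2 * g\<rbrakk> \<Longrightarrow> twist r u (w p) = twist_image r u p"
    unfolding twist_def by (rule e(4)) auto
qed

text \<open>Write \<open>D\<close> for the commutator. Handles before loop \<open>r\<close> are
  conjugated by \<open>D\<close>, the handle containing it acquires \<open>inv D\<close> on the left
  only, and later handles are fixed. Factors between neighbouring handles cancel, so
  \<open>D\<close> survives on the right only until the handle of \<open>r\<close> is
  reached.\<close>

lemma twist_surface_word:
  assumes "k \<le> g"
  shows "twist r u (surface_word G k w) = inv (gcomm G (inv (w r)) u) \<otimes> surface_word G k w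
    \<otimes> (if 2 * k < r then gcomm G (inv (w r)) u else \<one>)"
  using assms
proof (induction k)
  case 0
  then show ?case using r u by (simp add: endo_one [OF twist_hom])
next
  case (Suc k)
  let ?D = "gcomm G (inv (w r)) u"
  have Q: "surface_word G (Suc k) w = surface_word G k w
      \<otimes> (w (2 * k + 1) \<otimes> inv (w (2 * k + 2)) \<otimes> inv (w (2 * k + 1)) \<otimes> w (2 * k + 2))"
    using Suc.prems by (subst surface_word_Suc) (auto simp: gcomm_def)
  note simps = hom_mult [OF twist_hom] endo_inv [OF twist_hom] twist_w twist_image_def handle_pair_iff word_simps
  \<comment> \<open>The added handle consists of the loops \<open>2 * k + 1\<close> and
    \<open>2 * k + 2\<close>; the loop \<open>r\<close> comes after it, is one of the two, or comes
    before it.\<close>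
  consider "2 * k + 2 < r" | "r = 2 * k + 2" | "r = 2 * k + 1" | "r \<le> 2 * k" by linarith
  then show ?case
  proof cases
    case 1
    then show ?thesis unfolding Q using Suc r u by (simp add: simps)
  next
    case 2
    then have p: "Suc (Suc (2 * k)) = r" "2 * k + 1 < r" "Suc (2 * k + 1) = r" "2 * k < r" by simp_all
    show ?thesis unfolding Q using Suc r u by (simp add: simps p)
  next
    case 3
    then have p: "2 * k + 1 = r" "Suc (Suc (2 * k)) = Suc r" "2 * k < r" "odd r" by simp_all
    have "Suc r \<le> 2 * g" using 3 Suc.prems by simp
    then show ?thesis unfolding Q using Suc r u by (simp add: simps p)
  next
    case 4
    then have p: "\<not> handle_pair r (2 * k + 1)" "\<not> handle_pair r (2 * k + 2)"
      by (auto simp: handle_pair_iff)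
    show ?thesis unfolding Q using Suc r u 4 p by (simp add: simps(1-4) word_simps)
  qed
qed

lemma twist_t: "twist r u t = inv (gcomm G (inv (w r)) u) \<otimes> t"
proof -
  interpret h: group_hom G G "twist r u" using twist_hom by unfold_locales
  have "twist r u (T j) = T j" if "2 \<le> j" "j \<le> m + 1" for j
    using that
  proof (induction j rule: dec_induct)
    case (step j)
    then show ?case by (simp add: T_Suc twist_tau)
  qed simp
  then have "twist r u (T (m + 1)) = T (m + 1)" using m_ge_1 by simp
  \<comment> \<open>At \<open>k = g\<close> the right factor is trivial because
    \<open>r \<le> 2 * g\<close>, so the commutator appears on the left only.\<close>
  then show ?thesis
    using r u by (simp add: t_eq twist_surface_word m_assoc)
qed

end

section \<open>The automorphisms \<open>X r\<close> and their inverses\<close>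

lemma X_hom: "\<lbrakk>1 \<le> r; r \<le> 2 * g\<rbrakk> \<Longrightarrow> X r \<in> hom G G"
  and X_inv_hom: "\<lbrakk>1 \<le> r; r \<le> 2 * g\<rbrakk> \<Longrightarrow> X_inv r \<in> hom G G"
  and X_tau: "\<lbrakk>1 \<le> r; r \<le> 2 * g; 2 \<le> l; l \<le> m\<rbrakk> \<Longrightarrow> X r (\<tau> l) = \<tau> l"
  and X_inv_tau: "\<lbrakk>1 \<le> r; r \<le> 2 * g; 2 \<le> l; l \<le> m\<rbrakk> \<Longrightarrow> X_inv r (\<tau> l) = \<tau> l"
  unfolding X_def X_inv_def by (rule twist_hom twist_tau; simp)+

lemma X_t: "\<lbrakk>1 \<le> r; r \<le> 2 * g\<rbrakk> \<Longrightarrow> X r t = inv t \<otimes> w r \<otimes> t \<otimes> inv (w r) \<otimes> t"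
  unfolding X_def by (simp add: twist_t word_simps)

lemma X_inv_t: "\<lbrakk>1 \<le> r; r \<le> 2 * g\<rbrakk> \<Longrightarrow> X_inv r t = inv (w r) \<otimes> t \<otimes> w r"
  unfolding X_inv_def by (simp add: twist_t word_simps)

lemma X_w: "\<lbrakk>1 \<le> r; r \<le> 2 * g; 1 \<le> p; p \<le> 2 * g\<rbrakk> \<Longrightarrow> X r (w p) =
    (if p < r then inv t \<otimes> w r \<otimes> t \<otimes> inv (w r) \<otimes> w p
        \<otimes> (if handle_pair p r then t else w r \<otimes> inv t \<otimes> inv (w r) \<otimes> t)
    else if p = r then inv t \<otimes> w r \<otimes> t
    else (if handle_pair r p then inv t \<otimes> w p else w p))"
  unfolding X_def by (simp add: twist_w twist_image_def word_simps)

lemma X_inv_w: "\<lbrakk>1 \<le> r; r \<le> 2 * g; 1 \<le> p; p \<le> 2 * g\<rbrakk> \<Longrightarrow> X_inv r (w p) =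
    (if p < r then inv (w r) \<otimes> t \<otimes> w r \<otimes> inv t \<otimes> w p
        \<otimes> (if handle_pair p r then inv (w r) \<otimes> inv t \<otimes> w r else t \<otimes> inv (w r) \<otimes> inv t \<otimes> w r)
    else if p = r then inv (w r) \<otimes> t \<otimes> w r \<otimes> inv t \<otimes> w r
    else (if handle_pair r p then inv (w r) \<otimes> t \<otimes> w r \<otimes> w p else w p))"
  unfolding X_inv_def by (simp add: twist_w twist_image_def word_simps)

lemma X_auto: "\<lbrakk>1 \<le> r; r \<le> 2 * g\<rbrakk> \<Longrightarrow> X r \<in> auto G"
  and X_inv_auto: "\<lbrakk>1 \<le> r; r \<le> 2 * g\<rbrakk> \<Longrightarrow> X_inv r \<in> auto G"
  and X_X_inv: "\<lbrakk>1 \<le> r; r \<le> 2 * g; u \<in> carrier G\<rbrakk> \<Longrightarrow> X r (X_inv r u) = u"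
proof -
  assume r: "1 \<le> r" "r \<le> 2 * g"
  note x = X_hom [OF r] and x' = X_inv_hom [OF r]
  have ext: "X r \<in> extensional (carrier G)" "X_inv r \<in> extensional (carrier G)"
    unfolding X_def X_inv_def using r by (simp_all add: twist_extensional)
  have 1: "X r (X_inv r u) = u" if "u \<in> carrier G" for u
  proof (rule inverse_on_basis [OF x' x _ _ that])
    fix p assume "1 \<le> p" "p \<le> 2 * g"
    then show "X r (X_inv r (w p)) = w p"
      using r by (simp add: X_w X_inv_w X_t hom_mult [OF x] endo_inv [OF x] word_simps)
  qed (use r in \<open>simp add: X_tau X_inv_tau\<close>)
  have 2: "X_inv r (X r u) = u" if "u \<in> carrier G" for u
  proof (rule inverse_on_basis [OF x x' _ _ that])
    fix p assume "1 \<le> p" "p \<le> 2 * g"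
    then show "X_inv r (X r (w p)) = w p"
      using r by (simp add: X_w X_inv_w X_inv_t hom_mult [OF x'] endo_inv [OF x'] word_simps)
  qed (use r in \<open>simp add: X_tau X_inv_tau\<close>)
  show "X r \<in> auto G" "X_inv r \<in> auto G"
    by (rule autoI [OF x ext(1) x' 2 1] autoI [OF x' ext(2) x 1 2]; assumption)+
  show "u \<in> carrier G \<Longrightarrow> X r (X_inv r u) = u" by (rule 1)
qed

section \<open>The relations in the automorphism group\<close>

lemma Aut_apply:
  "\<lbrakk>\<alpha> \<in> carrier (Aut G); \<beta> \<in> carrier (Aut G); u \<in> carrier G\<rbrakk> \<Longrightarrow> (\<alpha> \<otimes>\<^bsub>Aut G\<^esub> \<beta>) u = \<beta> (\<alpha> u)"
  by (simp add: carrier_Aut mult_Aut)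

lemma Aut_hom: "\<alpha> \<in> carrier (Aut G) \<Longrightarrow> \<alpha> \<in> hom G G"
  by (simp add: carrier_Aut auto_def)

sublocale A: group "Aut G"
  by (rule group_Aut)

lemma sig_carrier [simp]: "\<lbrakk>1 \<le> k; k < m\<rbrakk> \<Longrightarrow> sig k \<in> carrier (Aut G)"
  and sig_inv_carrier [simp]: "\<lbrakk>1 \<le> k; k < m\<rbrakk> \<Longrightarrow> sig_inv k \<in> carrier (Aut G)"
  and X_carrier [simp]: "\<lbrakk>1 \<le> r; r \<le> 2 * g\<rbrakk> \<Longrightarrow> X r \<in> carrier (Aut G)"
  and X_inv_carrier [simp]: "\<lbrakk>1 \<le> r; r \<le> 2 * g\<rbrakk> \<Longrightarrow> X_inv r \<in> carrier (Aut G)"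
  by (simp_all add: carrier_Aut sig_auto sig_inv_auto X_auto X_inv_auto)

lemma inv_sig: "\<lbrakk>1 \<le> k; k < m\<rbrakk> \<Longrightarrow> inv\<^bsub>Aut G\<^esub> sig k = sig_inv k"
  by (rule A.inv_equality)
    (auto simp: mult_Aut sig_auto sig_inv_auto one_Aut sig_sig_inv intro!: restrict_ext)

lemma inv_X: "\<lbrakk>1 \<le> r; r \<le> 2 * g\<rbrakk> \<Longrightarrow> inv\<^bsub>Aut G\<^esub> X r = X_inv r"
  by (rule A.inv_equality)
    (auto simp: mult_Aut X_auto X_inv_auto one_Aut X_X_inv intro!: restrict_ext)

lemma Aut_eqI:
  assumes "\<alpha> \<in> carrier (Aut G)" "\<beta> \<in> carrier (Aut G)"
    and "\<And>i. \<lbrakk>2 \<le> i; i \<le> m\<rbrakk> \<Longrightarrow> \<alpha> (\<tau> i) = \<beta> (\<tau> i)"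
    and "\<And>r. \<lbrakk>1 \<le> r; r \<le> 2 * g\<rbrakk> \<Longrightarrow> \<alpha> (w r) = \<beta> (w r)"
  shows "\<alpha> = \<beta>"
  using assms by (intro auto_eqI) (auto simp: carrier_Aut)

lemmas sig_simps = hom_mult [OF sig_hom] endo_inv [OF sig_hom] sig_tau
  hom_mult [OF sig_inv_hom] endo_inv [OF sig_inv_hom] sig_inv_tau

lemma sig_braid:
  assumes "1 \<le> i" "Suc i < m"
  shows "sig i \<otimes>\<^bsub>Aut G\<^esub> sig (Suc i) \<otimes>\<^bsub>Aut G\<^esub> sig i
    = sig (Suc i) \<otimes>\<^bsub>Aut G\<^esub> sig i \<otimes>\<^bsub>Aut G\<^esub> sig (Suc i)"
  by (rule Aut_eqI) (use assms in \<open>auto simp: Aut_apply sig_simps word_simps\<close>)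

lemma sig_commute:
  assumes "1 \<le> i" "i < m" "1 \<le> j" "j < m" "Suc i < j \<or> Suc j < i"
  shows "sig i \<otimes>\<^bsub>Aut G\<^esub> sig j = sig j \<otimes>\<^bsub>Aut G\<^esub> sig i"
  by (rule Aut_eqI) (use assms in \<open>auto simp: Aut_apply sig_simps word_simps\<close>)

lemmas X_simps = hom_mult [OF X_hom] endo_inv [OF X_hom] X_t X_w X_tau
  hom_mult [OF X_inv_hom] endo_inv [OF X_inv_hom] X_inv_t X_inv_w X_inv_tau

lemmas endo_closed [simp] = hom_in_carrier [OF X_hom] hom_in_carrier [OF X_inv_hom]
  hom_in_carrier [OF sig_hom] hom_in_carrier [OF sig_inv_hom]

text \<open>For \<open>i \<ge> 2\<close> the map \<open>sig i\<close> fixes \<open>t\<close> and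
  every loop, hence every \<open>X r (w p)\<close>, while \<open>X r\<close> fixes the basis
  elements \<open>\<tau> l\<close> and so their images under \<open>sig i\<close>.\<close>

lemma X_sig_commute:
  assumes "1 \<le> r" "r \<le> 2 * g" "2 \<le> i" "i < m"
  shows "X r \<otimes>\<^bsub>Aut G\<^esub> sig i = sig i \<otimes>\<^bsub>Aut G\<^esub> X r"
proof (rule Aut_eqI)
  have t: "sig i t = t" using assms by (simp add: sig_t)
  show "(X r \<otimes>\<^bsub>Aut G\<^esub> sig i) (w p) = (sig i \<otimes>\<^bsub>Aut G\<^esub> X r) (w p)" if "1 \<le> p" "p \<le> 2 * g" for p
    using assms that by (auto simp: Aut_apply sig_simps X_simps t)
  show "(X r \<otimes>\<^bsub>Aut G\<^esub> sig i) (\<tau> l) = (sig i \<otimes>\<^bsub>Aut G\<^esub> X r) (\<tau> l)" if "2 \<le> l" "l \<le> m" for l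
    using assms that by (auto simp: Aut_apply sig_simps X_simps)
qed (use assms in auto)

section \<open>Relations between \<open>sig 1\<close> and the automorphisms
  \<open>X r\<close>\<close>

context
  assumes m: "2 \<le> m"
begin

lemma sig_1_simps:
  "sig 1 t = t \<otimes> \<tau> 2 \<otimes> inv t" "sig 1 (\<tau> 2) = t" "\<lbrakk>3 \<le> l; l \<le> m\<rbrakk> \<Longrightarrow> sig 1 (\<tau> l) = \<tau> l"
  "sig_inv 1 t = \<tau> 2" "sig_inv 1 (\<tau> 2) = inv (\<tau> 2) \<otimes> t \<otimes> \<tau> 2"
  "\<lbrakk>3 \<le> l; l \<le> m\<rbrakk> \<Longrightarrow> sig_inv 1 (\<tau> l) = \<tau> l"
  using m sig_t [of 1] sig_inv_t [of 1] sig_tau_basis [of 1 2] sig_inv_tau_basis [of 1 2]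
    sig_tau_basis [of 1 l] sig_inv_tau_basis [of 1 l]
  by (simp_all add: t_def [symmetric] Suc_1 Suc_eq_plus1)

lemmas mixed_simps = Aut_apply inv_sig X_simps sig_1_simps
  hom_mult [OF sig_hom] endo_inv [OF sig_hom] hom_mult [OF sig_inv_hom] endo_inv [OF sig_inv_hom]
  word_simps

lemma X_sig_1_self:
  assumes r: "1 \<le> r" "r \<le> 2 * g"
  shows "inv\<^bsub>Aut G\<^esub> sig 1 \<otimes>\<^bsub>Aut G\<^esub> X r \<otimes>\<^bsub>Aut G\<^esub> inv\<^bsub>Aut G\<^esub> sig 1 \<otimes>\<^bsub>Aut G\<^esub> X r
    = X r \<otimes>\<^bsub>Aut G\<^esub> (inv\<^bsub>Aut G\<^esub> sig 1 \<otimes>\<^bsub>Aut G\<^esub> X r \<otimes>\<^bsub>Aut G\<^esub> inv\<^bsub>Aut G\<^esub> sig 1)" (is "?L = ?R")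
proof (rule Aut_eqI)
  \<comment> \<open>Among the \<open>\<tau> l\<close> of the basis only \<open>\<tau> 2\<close> is
    moved by \<open>sig 1\<close>.\<close>
  show "?L (\<tau> l) = ?R (\<tau> l)" if "2 \<le> l" "l \<le> m" for l
    using r m that by (cases "l = 2") (simp add: mixed_simps, simp add: mixed_simps)
  fix p assume p: "1 \<le> p" "p \<le> 2 * g"
  \<comment> \<open>The position of \<open>p\<close> relative to \<open>r\<close>, and whether the
    two form a handle, decides every conditional in the images; what is left is free
    reduction.\<close>
  consider "p < r" "handle_pair p r" | "p < r" "\<not> handle_pair p r" | "p = r"
    | "r < p" "handle_pair r p" | "r < p" "\<not> handle_pair r p" by linarith
  then show "?L (w p) = ?R (w p)"
    by cases (use r m p in \<open>simp_all add: mixed_simps\<close>)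
qed (use r m in simp_all)

lemma X_sig_1_commute:
  assumes s: "1 \<le> s" and sr: "s < r" and r: "r \<le> 2 * g" and "\<not> handle_pair s r"
  shows "inv\<^bsub>Aut G\<^esub> sig 1 \<otimes>\<^bsub>Aut G\<^esub> X s \<otimes>\<^bsub>Aut G\<^esub> sig 1 \<otimes>\<^bsub>Aut G\<^esub> X r
    = X r \<otimes>\<^bsub>Aut G\<^esub> (inv\<^bsub>Aut G\<^esub> sig 1 \<otimes>\<^bsub>Aut G\<^esub> X s \<otimes>\<^bsub>Aut G\<^esub> sig 1)" (is "?L = ?R")
proof (rule Aut_eqI)
  show "?L (\<tau> l) = ?R (\<tau> l)" if "2 \<le> l" "l \<le> m" for l
    using s sr r m assms(4) that by (cases "l = 2") (simp add: mixed_simps, simp add: mixed_simps)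
  fix p assume p: "1 \<le> p" "p \<le> 2 * g"
  \<comment> \<open>Because \<open>s < r\<close>, an index below \<open>s\<close> is too far from
    \<open>r\<close> to be paired with it, and one above \<open>r\<close> too far from
    \<open>s\<close>. Parity forbids being second in one pair and first in another.\<close>
  have ex: "p < s \<Longrightarrow> \<not> handle_pair p r" "r < p \<Longrightarrow> \<not> handle_pair s p"
    "handle_pair s p \<Longrightarrow> \<not> handle_pair p r"
    using sr by (auto simp: handle_pair_iff)
  consider "p < s" "\<not> handle_pair p s" "\<not> handle_pair p r" | "p < s" "handle_pair p s" "\<not> handle_pair p r"
    | "p = s"
    | "s < p" "p < r" "\<not> handle_pair s p" "\<not> handle_pair p r"
    | "s < p" "p < r" "handle_pair s p" "\<not> handle_pair p r"
    | "s < p" "p < r" "\<not> handle_pair s p" "handle_pair p r"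
    | "p = r"
    | "r < p" "\<not> handle_pair s p" "\<not> handle_pair r p" | "r < p" "\<not> handle_pair s p" "handle_pair r p"
    using ex by (metis linorder_neqE_nat)
  then show "?L (w p) = ?R (w p)"
    by cases (use s sr r m p assms(4) in \<open>simp_all add: mixed_simps\<close>)
qed (use s sr r m in simp_all)

lemma X_sig_1_handle:
  assumes s: "1 \<le> s" and r: "r \<le> 2 * g" and sr: "handle_pair s r"
  shows "inv\<^bsub>Aut G\<^esub> sig 1 \<otimes>\<^bsub>Aut G\<^esub> X s \<otimes>\<^bsub>Aut G\<^esub> inv\<^bsub>Aut G\<^esub> sig 1 \<otimes>\<^bsub>Aut G\<^esub> X r
    = X r \<otimes>\<^bsub>Aut G\<^esub> (inv\<^bsub>Aut G\<^esub> sig 1 \<otimes>\<^bsub>Aut G\<^esub> X s \<otimes>\<^bsub>Aut G\<^esub> sig 1)" (is "?L = ?R")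
proof (rule Aut_eqI)
  have less: "s < r" using sr by (auto simp: handle_pair_iff)
  show "?L \<in> carrier (Aut G)" "?R \<in> carrier (Aut G)"
    using s less r m by simp_all
  show "?L (\<tau> l) = ?R (\<tau> l)" if "2 \<le> l" "l \<le> m" for l
    using s less r m sr that by (cases "l = 2") (simp add: mixed_simps, simp add: mixed_simps)
  fix p assume p: "1 \<le> p" "p \<le> 2 * g"
  \<comment> \<open>Since \<open>s\<close> is odd and \<open>r = Suc s\<close>, neither index has
    another partner and no index lies strictly between them.\<close>
  have ex: "p < s \<Longrightarrow> \<not> handle_pair p s" "p < s \<Longrightarrow> \<not> handle_pair p r"
    "r < p \<Longrightarrow> \<not> handle_pair s p" "r < p \<Longrightarrow> \<not> handle_pair r p"
    and r_eq: "r = Suc s"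
    using sr by (auto simp: handle_pair_iff)
  consider "p < s" "\<not> handle_pair p s" "\<not> handle_pair p r" | "p = s" | "p = r"
    | "r < p" "\<not> handle_pair s p" "\<not> handle_pair r p"
    using ex r_eq by (metis not_less_eq linorder_neqE_nat)
  then show "?L (w p) = ?R (w p)"
    by cases (use s less r m p sr in \<open>simp_all add: mixed_simps\<close>)
qed

end

section \<open>The surface relation\<close>

lemma gconj_surface_word:
  assumes "c \<in> carrier G" "\<And>r. r \<in> {1..2 * k} \<Longrightarrow> a r \<in> carrier G"
  shows "surface_word G k (\<lambda>r. gconj G (a r) c) = gconj G (surface_word G k a) c"
proof -
  interpret h: group_hom G G "\<lambda>u\<in>carrier G. gconj G u c"
    using inner_auto [OF assms(1)] by unfold_locales (simp add: auto_def)
  have "gconj G (surface_word G k a) c = surface_word G k (\<lambda>r. (\<lambda>u\<in>carrier G. gconj G u c) (a r))"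
    using h.hom_surface_word [of k a] surface_word_closed [of k a] assms by simp
  also have "\<dots> = surface_word G k (\<lambda>r. gconj G (a r) c)"
    using assms by (intro surface_word_cong) simp
  finally show ?thesis ..
qed

text \<open>For odd \<open>a\<close> this is one factor of the surface word formed from the
  \<open>X r\<close>.\<close>

definition handle :: "nat \<Rightarrow> 'a \<Rightarrow> 'a"
  where "handle a = gcomm (Aut G) (inv\<^bsub>Aut G\<^esub> X a) (X (Suc a))"

section \<open>The action of a single handle\<close>

context
  fixes a
  assumes a: "1 \<le> a" "Suc a \<le> 2 * g" "odd a"
begin

lemma handle_index_le: "a \<le> 2 * g"
  using a by simp

lemma handle_carrier: "handle a \<in> carrier (Aut G)"
  unfolding handle_def using a handle_index_le by (intro A.gcomm_closed A.inv_closed) auto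

lemma handle_apply:
  assumes "u \<in> carrier G"
  shows "handle a u = X (Suc a) (X_inv a (X_inv (Suc a) (X a u)))"
proof -
  \<comment> \<open>The double inverse in the commutator cancels. Automorphisms act on the right, so
    the leftmost factor \<open>X a\<close> is innermost in the nested application.\<close>
  have "handle a = X a \<otimes>\<^bsub>Aut G\<^esub> X_inv (Suc a) \<otimes>\<^bsub>Aut G\<^esub> X_inv a \<otimes>\<^bsub>Aut G\<^esub> X (Suc a)"
    using a handle_index_le by (simp add: handle_def gcomm_def flip: inv_X)
  then show ?thesis
    using a handle_index_le assms by (simp add: Aut_apply)
qed

lemma handle_tau: "\<lbrakk>2 \<le> l; l \<le> m\<rbrakk> \<Longrightarrow> handle a (\<tau> l) = \<tau> l"
  using a handle_index_le by (simp add: handle_apply X_simps)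

lemma handle_t: "handle a t = gconj G t (inv (gcomm G (inv (w a)) (w (Suc a))) \<otimes> t)"
  using a handle_index_le by (simp add: handle_apply X_simps handle_pair_iff word_simps)

text \<open>Loops before the handle are not simply fixed. Their conjugator times the image of
  \<open>t\<close> is again \<open>t\<close>, so the handle does fix \<open>gconj G (w p) t\<close>
  for them; this drives the induction in \<open>handles_w_t\<close>.\<close>

lemma handle_w:
  assumes p: "1 \<le> p" "p \<le> 2 * g"
  shows "handle a (w p) = (if p < a then gconj G (w p) (gcomm G (inv (gcomm G (inv (w a)) (w (Suc a)))) t)
    else if p \<le> Suc a then gconj G (w p) t else w p)"
proof -
  have a': "handle_pair a (Suc a)" using a by (simp add: handle_pair_iff)
  have ex: "p < a \<Longrightarrow> \<not> handle_pair p a" "p < a \<Longrightarrow> \<not> handle_pair p (Suc a)"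
    "Suc a < p \<Longrightarrow> \<not> handle_pair a p" "Suc a < p \<Longrightarrow> \<not> handle_pair (Suc a) p"
    using a by (auto simp: handle_pair_iff)
  consider "p < a" | "p = a" | "p = Suc a" | "Suc a < p" by linarith
  then show ?thesis
    by cases (use a handle_index_le a' p ex in \<open>simp_all add: handle_apply X_simps word_simps\<close>)
qed

end

section \<open>Products of the first handles\<close>

definition handles :: "nat \<Rightarrow> 'a \<Rightarrow> 'a"
  where "handles k = surface_word (Aut G) k X"

lemma handles_carrier: "k \<le> g \<Longrightarrow> handles k \<in> carrier (Aut G)"
  unfolding handles_def by (rule A.surface_word_closed) simp

lemma handles_Suc: "Suc k \<le> g \<Longrightarrow> handles (Suc k) = handles k \<otimes>\<^bsub>Aut G\<^esub> handle (2 * k + 1)"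
  unfolding handles_def handle_def by (subst A.surface_word_Suc) auto

lemma handles_tau: "\<lbrakk>k \<le> g; 2 \<le> l; l \<le> m\<rbrakk> \<Longrightarrow> handles k (\<tau> l) = \<tau> l"
proof (induction k)
  case 0
  then show ?case by (simp add: handles_def one_Aut)
next
  case (Suc k)
  then show ?case
    by (simp add: handles_Suc Aut_apply handles_carrier handle_carrier handle_tau)
qed

text \<open>Induction on the number of handles, the new one acting last. It fixes the conjugates by
  \<open>t\<close> of the earlier loops, conjugates its own two loops, unmoved so far, by
  \<open>t\<close>, and leaves the later ones alone.\<close>

lemma handles_w_t:
  assumes "k \<le> g"
  shows "handles k t = gconj G t (inv (surface_word G k w) \<otimes> t)
    \<and> (\<forall>p. 1 \<le> p \<longrightarrow> p \<le> 2 * g \<longrightarrow> handles k (w p) = (if p \<le> 2 * k then gconj G (w p) t else w p))"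
  using assms
proof (induction k)
  case 0
  then show ?case by (simp add: handles_def one_Aut word_simps)
next
  case (Suc k)
  define a where "a = 2 * k + 1"
  have a: "1 \<le> a" "Suc a \<le> 2 * g" "odd a" using Suc.prems by (auto simp: a_def)
  note h = Aut_hom [OF handle_carrier [OF a]]
  interpret h: group_hom G G "handle a" using h by unfold_locales
  define P where "P = gcomm G (inv (w a)) (w (Suc a))"
  define Q where "Q = surface_word G k w"
  define d where "d = gcomm G (inv P) t"
  have cl: "P \<in> carrier G" "Q \<in> carrier G" "d \<in> carrier G"
    using Suc.prems a by (auto simp: P_def Q_def d_def)
  have w_k: "w r \<in> carrier G" if "r \<in> {1..2 * k}" for r
    using that Suc.prems by simp
  have conj: "surface_word G k (\<lambda>r. handle a (w r)) = surface_word G k (\<lambda>r. gconj G (w r) d)"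
  proof (rule surface_word_cong)
    fix r assume "r \<in> {1..2 * k}"
    then have "1 \<le> r" "r < a" "r \<le> 2 * g" using Suc.prems by (auto simp: a_def)
    then show "handle a (w r) = gconj G (w r) d"
      by (simp add: handle_w [OF a] P_def d_def)
  qed
  \<comment> \<open>An endomorphism that conjugates all letters of \<open>Q\<close> by the same
    \<open>d\<close> conjugates \<open>Q\<close> by \<open>d\<close>.\<close>
  have Q: "handle a Q = gconj G Q d"
    using h.hom_surface_word [of k w] conj gconj_surface_word [of d k w] cl w_k
    by (simp only: Q_def)
  have Q_Suc: "surface_word G (Suc k) w = Q \<otimes> P"
    unfolding Q_def P_def a_def using Suc.prems by (subst surface_word_Suc) auto
  have t: "handle a t = gconj G t (inv P \<otimes> t)"
    unfolding P_def by (rule handle_t [OF a])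
  have H: "handles (Suc k) u = handle a (handles k u)" if "u \<in> carrier G" for u
    using Suc.prems that handle_carrier [OF a]
    by (simp add: handles_Suc Aut_apply handles_carrier a_def)
  \<comment> \<open>The product of \<open>d\<close> and \<open>handle a t\<close> is
    \<open>t\<close>, so the two successive conjugators combine to \<open>t\<close>.\<close>
  have conj_t: "handle a (gconj G (w p) t) = gconj G (w p) t" if "1 \<le> p" "p \<le> 2 * k" for p
  proof -
    have "p < a" "p \<le> 2 * g" using that Suc.prems by (auto simp: a_def)
    then have "handle a (w p) = gconj G (w p) d"
      using that by (simp add: handle_w [OF a] P_def d_def)
    then show ?thesis
      using that \<open>p \<le> 2 * g\<close> cl by (simp add: h.hom_gconj t) (simp add: d_def word_simps)
  qed
  show ?case
  proof (intro conjI allI impI)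
    have "handles (Suc k) t = gconj G (gconj G t (inv P \<otimes> t)) (inv (gconj G Q d) \<otimes> gconj G t (inv P \<otimes> t))"
      using Suc cl by (simp add: H h.hom_gconj t Q flip: Q_def)
    \<comment> \<open>The image of \<open>t\<close> equals \<open>inv d \<otimes> t\<close>, so the
      conjugation of \<open>Q\<close> by \<open>d\<close> cancels and the factor \<open>P\<close>
      joins \<open>Q\<close>.\<close>
    also have "\<dots> = gconj G t (inv (Q \<otimes> P) \<otimes> t)"
      using cl by (simp add: d_def word_simps)
    finally show "handles (Suc k) t = gconj G t (inv (surface_word G (Suc k) w) \<otimes> t)"
      by (simp add: Q_Suc)
  next
    fix p assume p: "1 \<le> p" "p \<le> 2 * g"
    consider "p \<le> 2 * k" | "p = a \<or> p = Suc a" | "Suc a < p"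
      unfolding a_def by linarith
    then show "handles (Suc k) (w p) = (if p \<le> 2 * Suc k then gconj G (w p) t else w p)"
    proof cases
      case 1
      then show ?thesis using Suc p by (simp add: H conj_t)
    next
      case 2
      then have "a \<le> p" "p \<le> Suc a" "2 * k < p" "p \<le> 2 * Suc k" by (auto simp: a_def)
      then show ?thesis using Suc p by (simp add: H handle_w [OF a])
    next
      case 3
      then have "2 * k < p" "2 * Suc k < p" by (auto simp: a_def)
      then show ?thesis using Suc p 3 by (simp add: H handle_w [OF a])
    qed
  qed
qed

section \<open>The palindromic word in the \<open>sig k\<close>\<close>

definition sig_palindrome :: "nat \<Rightarrow> 'a \<Rightarrow> 'a"
  where "sig_palindrome j = gprod (Aut G) (map sig ([j..<m] @ rev [j..<m]))"

lemma sig_palindrome_m: "sig_palindrome m = \<one>\<^bsub>Aut G\<^esub>"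
  by (simp add: sig_palindrome_def)

lemma sig_palindrome_carrier: "1 \<le> j \<Longrightarrow> sig_palindrome j \<in> carrier (Aut G)"
  unfolding sig_palindrome_def by (rule A.gprod_closed) auto

text \<open>Letting the starting index vary makes each palindrome the next shorter one enclosed in a
  further letter, the form suited to downward induction.\<close>

lemma sig_palindrome_step:
  assumes "1 \<le> j" "j < m"
  shows "sig_palindrome j = sig j \<otimes>\<^bsub>Aut G\<^esub> sig_palindrome (Suc j) \<otimes>\<^bsub>Aut G\<^esub> sig j"
proof -
  let ?l = "map sig ([Suc j..<m] @ rev [Suc j..<m])"
  have "map sig ([j..<m] @ rev [j..<m]) = sig j # (?l @ [sig j])"
    using upt_conv_Cons [OF assms(2)] by simp
  moreover have "set ?l \<subseteq> carrier (Aut G)"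
    by auto
  ultimately show ?thesis
    unfolding sig_palindrome_def using assms by (simp only: A.gprod_Cons) (simp add: A.gprod_append A.m_assoc)
qed

text \<open>Downward induction from the empty word at \<open>j = m\<close>. The value at
  \<open>\<tau> j\<close> is left open; at \<open>j = 1\<close> the remaining
  \<open>\<tau> l\<close> are exactly those in the basis.\<close>

lemma sig_palindrome:
  assumes "1 \<le> j" "j \<le> m"
  shows "(\<forall>l. 1 \<le> l \<longrightarrow> l \<le> m \<longrightarrow> l \<noteq> j \<longrightarrow> sig_palindrome j (\<tau> l) =
      (if j < l then gconj G (\<tau> l) (inv (\<tau> j)) else \<tau> l))
    \<and> (\<forall>p. 1 \<le> p \<longrightarrow> p \<le> 2 * g \<longrightarrow> sig_palindrome j (w p) = w p)"
  using assms(2,1)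
proof (induction j rule: inc_induct)
  case base
  then show ?case by (auto simp: sig_palindrome_m one_Aut)
next
  case (step j)
  have step_eq: "sig_palindrome j u = sig j (sig_palindrome (Suc j) (sig j u))" if "u \<in> carrier G" for u
    using step.hyps step.prems that by (simp add: sig_palindrome_step Aut_apply sig_palindrome_carrier)
  have IH_tau: "sig_palindrome (Suc j) (\<tau> l) = (if Suc j < l then gconj G (\<tau> l) (inv (\<tau> (Suc j))) else \<tau> l)"
    if "1 \<le> l" "l \<le> m" "l \<noteq> Suc j" for l
    using step.IH that by simp
  have IH_w: "sig_palindrome (Suc j) (w p) = w p" if "1 \<le> p" "p \<le> 2 * g" for p
    using step.IH that by simp
  show ?case
  proof (intro conjI allI impI)
    fix l assume l: "1 \<le> l" "l \<le> m" "l \<noteq> j"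
    \<comment> \<open>For \<open>l = Suc j\<close> the first \<open>sig j\<close> yields
      \<open>\<tau> j\<close>, which the inner palindrome fixes. For larger \<open>l\<close> the
      inner conjugation by \<open>inv (\<tau> (Suc j))\<close> becomes one by
      \<open>inv (\<tau> j)\<close> under the last \<open>sig j\<close>.\<close>
    consider "l < j" | "l = Suc j" | "Suc j < l" using l by linarith
    then show "sig_palindrome j (\<tau> l) = (if j < l then gconj G (\<tau> l) (inv (\<tau> j)) else \<tau> l)"
      by cases (use l step.hyps step.prems in \<open>simp_all add: step_eq sig_simps IH_tau gconj_def\<close>)
  next
    fix p assume "1 \<le> p" "p \<le> 2 * g"
    then show "sig_palindrome j (w p) = w p"
      using step.hyps step.prems by (simp add: step_eq IH_w)
  qed
qed

lemma surface_relation: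
  "surface_word (Aut G) g X = gprod (Aut G) (map sig ([1..<m] @ rev [1..<m]))
    \<otimes>\<^bsub>Aut G\<^esub> (\<lambda>u\<in>carrier G. gconj G u t)"
proof (rule Aut_eqI)
  have c: "(\<lambda>u\<in>carrier G. gconj G u t) \<in> carrier (Aut G)"
    by (simp add: carrier_Aut inner_auto)
  note p = sig_palindrome_carrier [of 1] sig_palindrome [of 1]
  note fold = sig_palindrome_def [symmetric] handles_def [symmetric]
  show "surface_word (Aut G) g X \<in> carrier (Aut G)"
    unfolding fold by (simp add: handles_carrier)
  show "gprod (Aut G) (map sig ([1..<m] @ rev [1..<m]))
    \<otimes>\<^bsub>Aut G\<^esub> (\<lambda>u\<in>carrier G. gconj G u t) \<in> carrier (Aut G)"
    unfolding fold using c p by simp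
  \<comment> \<open>On the right \<open>\<tau> l\<close> is conjugated by \<open>inv t\<close> and
    then by \<open>t\<close>, so both sides fix it.\<close>
  show "surface_word (Aut G) g X (\<tau> l) = (gprod (Aut G) (map sig ([1..<m] @ rev [1..<m]))
    \<otimes>\<^bsub>Aut G\<^esub> (\<lambda>u\<in>carrier G. gconj G u t)) (\<tau> l)" if "2 \<le> l" "l \<le> m" for l
    unfolding fold using c p that by (simp add: Aut_apply handles_tau gconj_gconj gconj_one flip: t_def)
  show "surface_word (Aut G) g X (w r) = (gprod (Aut G) (map sig ([1..<m] @ rev [1..<m]))
    \<otimes>\<^bsub>Aut G\<^esub> (\<lambda>u\<in>carrier G. gconj G u t)) (w r)" if "1 \<le> r" "r \<le> 2 * g" for r
    unfolding fold using c p that m_ge_1 handles_w_t [of g] by (simp add: Aut_apply)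
qed

section \<open>The representation of the braid group\<close>

lemma braid_representation:
  "\<exists>\<rho> \<in> hom (surface_braid_group m g) (Out G).
    (\<forall>k\<in>{1..m - 1}. \<rho> (braid_sigma m g k) = out_class G (sig k)) \<and>
    (\<forall>r\<in>{1..2 * g}. \<rho> (braid_x m g r) = out_class G (X r))"
proof -
  let ?S = "braid_letters m g"
  let ?F = "free_group ?S"
  let ?\<sigma> = "\<lambda>i. free_gen (SigmaGen i)"
  let ?x = "\<lambda>r. free_gen (XGen r)"
  interpret F: group ?F by (rule group_free_group)
  define f where "f l = (case l of SigmaGen k \<Rightarrow> sig k | XGen r \<Rightarrow> X r)" for l
  have "f \<in> ?S \<rightarrow> carrier (Aut G)"
    by (auto simp: f_def braid_letters_def)
  then obtain \<phi> where \<phi>: "\<phi> \<in> hom ?F (Aut G)" "\<And>l. l \<in> ?S \<Longrightarrow> \<phi> (free_gen l) = f l"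
    using free_group_universal [OF group_Aut, of f ?S] by blast
  interpret \<phi>: group_hom ?F "Aut G" \<phi>
    using \<phi>(1) by unfold_locales
  have \<sigma> [simp]: "?\<sigma> i \<in> carrier ?F" "\<phi> (?\<sigma> i) = sig i" if "1 \<le> i" "i < m" for i
    using that by (auto simp: \<phi>(2) f_def braid_letters_def)
  have x [simp]: "?x r \<in> carrier ?F" "\<phi> (?x r) = X r" if "1 \<le> r" "r \<le> 2 * g" for r
    using that by (auto simp: \<phi>(2) f_def braid_letters_def)
  \<comment> \<open>The relations are tested for the composite into \<open>Out G\<close>: the others
    are verified already for \<open>\<phi>\<close>, the surface relation modulo an inner
    automorphism.\<close>
  define h where "h u = out_class G (\<phi> u)" for u
  have "h \<in> hom ?F (Out G)"
    using \<phi>.hom_closed hom_in_carrier [OF out_class_hom] hom_mult [OF out_class_hom]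
    by (auto simp: hom_def h_def)
  have surf: "surface_word ?F g ?x \<in> carrier ?F" "gprod ?F (map ?\<sigma> ([1..<m] @ rev [1..<m])) \<in> carrier ?F"
    "h (surface_word ?F g ?x) = h (gprod ?F (map ?\<sigma> ([1..<m] @ rev [1..<m])))"
  proof -
    let ?l = "[1..<m] @ rev [1..<m]"
    have l: "set (map ?\<sigma> ?l) \<subseteq> carrier ?F" by auto
    show 1: "surface_word ?F g ?x \<in> carrier ?F" by (rule F.surface_word_closed) simp
    show 2: "gprod ?F (map ?\<sigma> ?l) \<in> carrier ?F" by (rule F.gprod_closed [OF l])
    have "\<phi> (surface_word ?F g ?x) = surface_word (Aut G) g (\<lambda>r. \<phi> (?x r))"
      by (rule \<phi>.hom_surface_word) simp
    also have "\<dots> = surface_word (Aut G) g X"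
      by (rule A.surface_word_cong) simp
    finally have "\<phi> (surface_word ?F g ?x) = surface_word (Aut G) g X" .
    moreover have "map \<phi> (map ?\<sigma> ?l) = map sig ?l" by simp
    then have gp: "\<phi> (gprod ?F (map ?\<sigma> ?l)) = gprod (Aut G) (map sig ?l)"
      using \<phi>.hom_gprod [OF l] by (simp only:)
    moreover have "gprod (Aut G) (map sig ?l) \<in> auto G"
      using \<phi>.hom_closed [OF 2] unfolding gp carrier_Aut .
    moreover have "(\<lambda>u\<in>carrier G. gconj G u t) \<in> Inn G"
      using t_closed unfolding Inn_def by blast
    ultimately show "h (surface_word ?F g ?x) = h (gprod ?F (map ?\<sigma> ?l))"
      unfolding h_def by (simp only: surface_relation out_class_mult_Inn)
  qed
  have rel: "u \<in> carrier ?F \<and> v \<in> carrier ?F \<and> h u = h v" if uv: "(u, v) \<in> braid_relations m g" for u v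
  proof (cases "m = 1")
    case True
    \<comment> \<open>On one strand the palindrome is the empty product, so the relation of the
      fundamental group is an instance of \<open>surf\<close>.\<close>
    then have no_sigma: "[1..<m] = []" by simp
    have "gprod ?F (map ?\<sigma> ([1..<m] @ rev [1..<m])) = \<one>\<^bsub>?F\<^esub>"
      unfolding no_sigma by simp
    moreover have "braid_relations m g = {(surface_word ?F g ?x, \<one>\<^bsub>?F\<^esub>)}"
      unfolding braid_relations_def Let_def if_P [OF True] by (rule refl)
    ultimately show ?thesis
      using uv surf by simp
  next
    case False
    then have m: "2 \<le> m" "1 < m" using m_ge_1 by auto
    consider
        i where "u = ?\<sigma> i \<otimes>\<^bsub>?F\<^esub> ?\<sigma> (i + 1) \<otimes>\<^bsub>?F\<^esub> ?\<sigma> i"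
          "v = ?\<sigma> (i + 1) \<otimes>\<^bsub>?F\<^esub> ?\<sigma> i \<otimes>\<^bsub>?F\<^esub> ?\<sigma> (i + 1)" "1 \<le> i" "i + 1 \<le> m - 1"
      | i j where "u = ?\<sigma> i \<otimes>\<^bsub>?F\<^esub> ?\<sigma> j" "v = ?\<sigma> j \<otimes>\<^bsub>?F\<^esub> ?\<sigma> i"
          "i \<in> {1..m - 1}" "j \<in> {1..m - 1}" "\<bar>int i - int j\<bar> > 1"
      | r i where "u = ?x r \<otimes>\<^bsub>?F\<^esub> ?\<sigma> i" "v = ?\<sigma> i \<otimes>\<^bsub>?F\<^esub> ?x r"
          "r \<in> {1..2 * g}" "i \<in> {1..m - 1}" "i \<noteq> 1"
      | r where "u = (inv\<^bsub>?F\<^esub> ?\<sigma> 1 \<otimes>\<^bsub>?F\<^esub> ?x r \<otimes>\<^bsub>?F\<^esub> inv\<^bsub>?F\<^esub> ?\<sigma> 1) \<otimes>\<^bsub>?F\<^esub> ?x r"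
          "v = ?x r \<otimes>\<^bsub>?F\<^esub> (inv\<^bsub>?F\<^esub> ?\<sigma> 1 \<otimes>\<^bsub>?F\<^esub> ?x r \<otimes>\<^bsub>?F\<^esub> inv\<^bsub>?F\<^esub> ?\<sigma> 1)" "r \<in> {1..2 * g}"
      | s r where "u = (inv\<^bsub>?F\<^esub> ?\<sigma> 1 \<otimes>\<^bsub>?F\<^esub> ?x s \<otimes>\<^bsub>?F\<^esub> ?\<sigma> 1) \<otimes>\<^bsub>?F\<^esub> ?x r"
          "v = ?x r \<otimes>\<^bsub>?F\<^esub> (inv\<^bsub>?F\<^esub> ?\<sigma> 1 \<otimes>\<^bsub>?F\<^esub> ?x s \<otimes>\<^bsub>?F\<^esub> ?\<sigma> 1)"
          "1 \<le> s" "s < r" "r \<le> 2 * g" "\<not> handle_pair s r"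
      | k where "u = (inv\<^bsub>?F\<^esub> ?\<sigma> 1 \<otimes>\<^bsub>?F\<^esub> ?x (2 * k - 1) \<otimes>\<^bsub>?F\<^esub> inv\<^bsub>?F\<^esub> ?\<sigma> 1) \<otimes>\<^bsub>?F\<^esub> ?x (2 * k)"
          "v = ?x (2 * k) \<otimes>\<^bsub>?F\<^esub> (inv\<^bsub>?F\<^esub> ?\<sigma> 1 \<otimes>\<^bsub>?F\<^esub> ?x (2 * k - 1) \<otimes>\<^bsub>?F\<^esub> ?\<sigma> 1)" "k \<in> {1..g}"
      | "u = surface_word ?F g ?x" "v = gprod ?F (map ?\<sigma> ([1..<m] @ rev [1..<m]))"
      using uv False unfolding braid_relations_def Let_def if_not_P [OF False] Un_iff mem_Collect_eq by blast
    then show ?thesis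
    proof cases
      case 1
      then show ?thesis using sig_braid [of i] by (simp add: h_def flip: Suc_eq_plus1)
    next
      case 2
      then have "Suc i < j \<or> Suc j < i" "1 \<le> i" "i < m" "1 \<le> j" "j < m" by auto
      then show ?thesis using 2 sig_commute [of i j] by (simp add: h_def)
    next
      case 3
      then have "1 \<le> r" "r \<le> 2 * g" "2 \<le> i" "1 \<le> i" "i < m" by auto
      then show ?thesis using 3 X_sig_commute [of r i] by (simp add: h_def)
    next
      case 4
      then show ?thesis using m X_sig_1_self [of r] by (simp add: h_def)
    next
      case 5
      then show ?thesis using m X_sig_1_commute [of s r] by (simp add: h_def)
    next
      case 6
      then have "1 \<le> 2 * k - 1" "2 * k \<le> 2 * g" "2 * k - 1 \<le> 2 * g" "1 \<le> 2 * k" "handle_pair (2 * k - 1) (2 * k)"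
        by (auto simp: handle_pair_iff)
      then show ?thesis using 6 m X_sig_1_handle [of "2 * k - 1" "2 * k"] by (simp add: h_def)
    next
      case 7
      then show ?thesis using surf by simp
    qed
  qed
  have "braid_relations m g \<subseteq> carrier ?F \<times> carrier ?F"
    using rel by auto
  then obtain \<rho> where \<rho>: "\<rho> \<in> hom (presented_group ?S (braid_relations m g)) (Out G)"
    "\<And>l. l \<in> ?S \<Longrightarrow> \<rho> (presented_gen ?S (braid_relations m g) l) = h (free_gen l)"
    using presented_group_hom [OF group_Out \<open>h \<in> hom ?F (Out G)\<close>, of "braid_relations m g"] rel by metis
  show ?thesis
  proof (intro bexI [of _ \<rho>] conjI ballI)
    show "\<rho> \<in> hom (surface_braid_group m g) (Out G)"
      unfolding surface_braid_group_def by (rule \<rho>)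
    show "\<rho> (braid_sigma m g k) = out_class G (sig k)" if "k \<in> {1..m - 1}" for k
    proof -
      have "SigmaGen k \<in> ?S" "1 \<le> k" "k < m" using that by (auto simp: braid_letters_def)
      then show ?thesis by (simp add: braid_sigma_def \<rho>(2) h_def)
    qed
    show "\<rho> (braid_x m g r) = out_class G (X r)" if "r \<in> {1..2 * g}" for r
    proof -
      have "XGen r \<in> ?S" "1 \<le> r" "r \<le> 2 * g" using that by (auto simp: braid_letters_def)
      then show ?thesis by (simp add: braid_x_def \<rho>(2) h_def)
    qed
  qed
qed

end

section \<open>The concrete free group as an instance\<close>

lemma surface_free_group_V_group:
  assumes "1 \<le> m"
  shows "surface_free_group (V_group m g) m g (tau m g) w_gen"
proof -
  let ?S = "TauGen ` {2..m} \<union> WGen ` {1..2 * g}"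
  interpret group "V_group m g"
    unfolding V_group_def by (rule group_free_group)
  have tau: "tau m g i = free_gen (TauGen i)" if "2 \<le> i" for i
    using that by (simp add: tau_def)
  show ?thesis
  proof unfold_locales
    show "1 \<le> m" by fact
    show "tau m g i \<in> carrier (V_group m g)" if "i \<in> {2..m}" for i
      using that by (auto simp: tau V_group_def)
    show "w_gen r \<in> carrier (V_group m g)" if "r \<in> {1..2 * g}" for r
      using that by (auto simp: w_gen_def V_group_def)
    have "map (\<lambda>j. inv\<^bsub>V_group m g\<^esub> tau m g j) (rev [2..<m + 1])
        = map (\<lambda>j. inv\<^bsub>V_group m g\<^esub> free_gen (TauGen j)) (rev [2..<m + 1])"
      by (rule map_cong) (auto simp: tau)
    then show "tau m g 1 = surface_word (V_group m g) g w_gen \<otimes>\<^bsub>V_group m g\<^esub>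
        gprod (V_group m g) (map (\<lambda>j. inv\<^bsub>V_group m g\<^esub> tau m g j) (rev [2..<m + 1]))"
      by (simp only: tau_def [of m g 1] if_True simp_thms)
  next
    fix a b :: "nat \<Rightarrow> V_letter word"
    assume a: "a \<in> {2..m} \<rightarrow> carrier (V_group m g)" and b: "b \<in> {1..2 * g} \<rightarrow> carrier (V_group m g)"
    \<comment> \<open>A map on the basis is a pair of maps on the two kinds of letters, here joined
      into one.\<close>
    have "case_V_letter a b \<in> ?S \<rightarrow> carrier (V_group m g)"
      using a b by auto
    then have "\<exists>!h. h \<in> hom (V_group m g) (V_group m g) \<inter> extensional (carrier (V_group m g))
        \<and> (\<forall>l\<in>?S. h (free_gen l) = case_V_letter a b l)"
      using free_group_universal [OF is_group, of "case_V_letter a b" ?S] by (simp only: V_group_def)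
    moreover have "(\<forall>l\<in>?S. h (free_gen l) = case_V_letter a b l)
        \<longleftrightarrow> (\<forall>i\<in>{2..m}. h (tau m g i) = a i) \<and> (\<forall>r\<in>{1..2 * g}. h (w_gen r) = b r)" for h
      by (auto simp: ball_Un tau w_gen_def)
    ultimately show "\<exists>!h. h \<in> hom (V_group m g) (V_group m g) \<inter> extensional (carrier (V_group m g))
        \<and> (\<forall>i\<in>{2..m}. h (tau m g i) = a i) \<and> (\<forall>r\<in>{1..2 * g}. h (w_gen r) = b r)"
      by simp
  qed
qed

section \<open>The action formulas in the concrete group\<close>

theorem proposition8:
  fixes g n :: nat
  assumes "g \<ge> 1" and "n > 1"
  shows "let G = V_group (n - 1) g; \<tau> = tau (n - 1) g; w = w_gen in
    \<exists>\<rho> \<in> hom (surface_braid_group (n - 1) g) (Out G).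
    \<exists>\<sigma>\<sigma> xx.
      (\<forall>k\<in>{1..n - 2}. \<sigma>\<sigma> k \<in> auto G \<and> \<rho> (braid_sigma (n - 1) g k) = out_class G (\<sigma>\<sigma> k)) \<and>
      (\<forall>r\<in>{1..2 * g}. xx r \<in> auto G \<and> \<rho> (braid_x (n - 1) g r) = out_class G (xx r)) \<and>
      (\<forall>l\<in>{2..n - 1}. \<forall>k\<in>{1..n - 2}. k \<noteq> l - 1 \<and> k \<noteq> l \<longrightarrow> \<sigma>\<sigma> k (\<tau> l) = \<tau> l) \<and>
      (\<forall>l\<in>{2..n - 1}. \<sigma>\<sigma> (l - 1) (\<tau> l) = \<tau> (l - 1)) \<and>
      (\<forall>l\<in>{2..n - 1}. l \<noteq> n - 1 \<longrightarrow> \<sigma>\<sigma> l (\<tau> l) = gconj G (\<tau> (l + 1)) (inv\<^bsub>G\<^esub> \<tau> l)) \<and>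
      (\<forall>i\<in>{2..n - 1}. \<forall>r\<in>{1..2 * g}. xx r (\<tau> i) = \<tau> i) \<and>
      (\<forall>r\<in>{1..2 * g}. \<forall>i\<in>{1..n - 2}. \<sigma>\<sigma> i (w r) = w r) \<and>
      (\<forall>r\<in>{1..2 * g}. xx r (w r) = gconj G (w r) (\<tau> 1)) \<and>
      (\<forall>r\<in>{1..2 * g}. xx r (\<tau> 1) = gconj G (\<tau> 1) (inv\<^bsub>G\<^esub> w r \<otimes>\<^bsub>G\<^esub> \<tau> 1)) \<and>
      (\<forall>s r. 1 \<le> s \<and> s < r \<and> r \<le> 2 * g \<and> \<not> handle_pair s r \<longrightarrow>
         xx r (w s) = gconj G (w s) (gcomm G (inv\<^bsub>G\<^esub> w r) (\<tau> 1))) \<and>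
      (\<forall>s r. 1 \<le> s \<and> s < r \<and> r \<le> 2 * g \<and> \<not> handle_pair s r \<longrightarrow> xx s (w r) = w r) \<and>
      (\<forall>m\<in>{1..g}. xx (2 * m) (w (2 * m - 1)) =
         gcomm G (\<tau> 1) (inv\<^bsub>G\<^esub> w (2 * m)) \<otimes>\<^bsub>G\<^esub> w (2 * m - 1) \<otimes>\<^bsub>G\<^esub> \<tau> 1) \<and>
      (\<forall>m\<in>{1..g}. xx (2 * m - 1) (w (2 * m)) = inv\<^bsub>G\<^esub> \<tau> 1 \<otimes>\<^bsub>G\<^esub> w (2 * m))"
proof -
  \<comment> \<open>The parameter \<open>m\<close> is the number of strands \<open>n - 1\<close>,
    which is at least 1 because \<open>n > 1\<close>.\<close>
  interpret V: surface_free_group "V_group (n - 1) g" "n - 1" g "tau (n - 1) g" w_gen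
    by (rule surface_free_group_V_group) (use assms(2) in simp)
  obtain \<rho> where \<rho>: "\<rho> \<in> hom (surface_braid_group (n - 1) g) (Out (V_group (n - 1) g))"
    "\<forall>k\<in>{1..n - 2}. \<rho> (braid_sigma (n - 1) g k) = out_class (V_group (n - 1) g) (V.sig k)"
    "\<forall>r\<in>{1..2 * g}. \<rho> (braid_x (n - 1) g r) = out_class (V_group (n - 1) g) (V.X r)"
    using V.braid_representation by (metis diff_diff_left one_add_one)
  \<comment> \<open>Stated for an arbitrary handle pair so that the conditionals in
    \<open>V.X_w\<close> are decided directly; the indices \<open>2 * k - 1\<close> and
    \<open>2 * k\<close> are substituted at the end.\<close>
  have pair: "V.X r (w_gen s) = gcomm (V_group (n - 1) g) V.t
        (inv\<^bsub>V_group (n - 1) g\<^esub> w_gen r) \<otimes>\<^bsub>V_group (n - 1) g\<^esub> w_gen s \<otimes>\<^bsub>V_group (n - 1) g\<^esub> V.t"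
      "V.X s (w_gen r) = inv\<^bsub>V_group (n - 1) g\<^esub> V.t \<otimes>\<^bsub>V_group (n - 1) g\<^esub> w_gen r"
    if "1 \<le> s" "r \<le> 2 * g" and sr: "handle_pair s r" for s r
  proof -
    have "s < r" using sr by (auto simp: handle_pair_iff)
    then show "V.X r (w_gen s) = gcomm (V_group (n - 1) g) V.t
        (inv\<^bsub>V_group (n - 1) g\<^esub> w_gen r) \<otimes>\<^bsub>V_group (n - 1) g\<^esub> w_gen s \<otimes>\<^bsub>V_group (n - 1) g\<^esub> V.t"
      "V.X s (w_gen r) = inv\<^bsub>V_group (n - 1) g\<^esub> V.t \<otimes>\<^bsub>V_group (n - 1) g\<^esub> w_gen r"
      using that by (simp_all add: V.X_w V.word_simps)
  qed
  note t = V.t_def [symmetric]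
  show ?thesis
    unfolding Let_def t
  proof (rule bexI [OF _ \<rho>(1)], rule exI [of _ V.sig], rule exI [of _ V.X], intro conjI ballI allI impI)
    fix k assume "k \<in> {1..n - 2}"
    then show "V.sig k \<in> auto (V_group (n - 1) g)"
      "\<rho> (braid_sigma (n - 1) g k) = out_class (V_group (n - 1) g) (V.sig k)"
      using V.sig_auto [of k] \<rho>(2) by auto
  next
    fix l k assume "l \<in> {2..n - 1}" "k \<in> {1..n - 2}" "k \<noteq> l - 1 \<and> k \<noteq> l"
    then show "V.sig k (tau (n - 1) g l) = tau (n - 1) g l"
      by (subst V.sig_tau) auto
  next
    fix l assume "l \<in> {2..n - 1}"
    then show "V.sig (l - 1) (tau (n - 1) g l) = tau (n - 1) g (l - 1)"
      by (subst V.sig_tau) auto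
  next
    fix l assume l: "l \<in> {2..n - 1}" "l \<noteq> n - 1"
    then have "1 \<le> l" "l < n - 1" "l \<le> n - 1" by auto
    then show "V.sig l (tau (n - 1) g l)
        = gconj (V_group (n - 1) g) (tau (n - 1) g (l + 1)) (inv\<^bsub>V_group (n - 1) g\<^esub> tau (n - 1) g l)"
      by (subst V.sig_tau) (simp_all add: gconj_def flip: Suc_eq_plus1)
  next
    fix s r assume sr: "1 \<le> s \<and> s < r \<and> r \<le> 2 * g \<and> \<not> handle_pair s r"
    then show "V.X r (w_gen s) = gconj (V_group (n - 1) g) (w_gen s)
        (gcomm (V_group (n - 1) g) (inv\<^bsub>V_group (n - 1) g\<^esub> w_gen r) V.t)"
      "V.X s (w_gen r) = w_gen r"
      by (simp_all add: V.X_w V.word_simps)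
  next
    fix k assume "k \<in> {1..g}"
    then have k: "1 \<le> 2 * k - 1" "2 * k \<le> 2 * g" "handle_pair (2 * k - 1) (2 * k)"
      by (auto simp: handle_pair_iff)
    show "V.X (2 * k) (w_gen (2 * k - 1)) = gcomm (V_group (n - 1) g) V.t
          (inv\<^bsub>V_group (n - 1) g\<^esub> w_gen (2 * k)) \<otimes>\<^bsub>V_group (n - 1) g\<^esub> w_gen (2 * k - 1)
          \<otimes>\<^bsub>V_group (n - 1) g\<^esub> V.t"
      "V.X (2 * k - 1) (w_gen (2 * k)) = inv\<^bsub>V_group (n - 1) g\<^esub> V.t \<otimes>\<^bsub>V_group (n - 1) g\<^esub> w_gen (2 * k)"
      using pair [OF k] by simp_all
  \<comment> \<open>What remains is that each \<open>V.X r\<close> is an automorphism of the right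
    class, its values on \<open>\<tau> i\<close>, on its own loop and on \<open>t\<close>, and the
    loops fixed by \<open>V.sig\<close>.\<close>
  qed (auto simp: V.X_auto \<rho>(3) V.X_tau V.X_w V.X_t V.word_simps)
qed

end
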